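(* Let $N=N_1\circ N_2$ be a feedforward coalescence network with coalescence cell $c$, where $N_1,N_2$ have $n_1,n_2$ cells, let $F^N$ be an $N$-admissible diffusive system, with $F^{N_1},F^{N_2}$ the corresponding admissible systems of $N_1,N_2$, and let $(b_1,b_c):D_1\to\mathbb{R}^{n_1-1}\times\mathbb{R}$ be a bifurcation branch for $F^{N_1}$. Suppose that $\underline{\overline{J}}{}_F^{N_2}$ has rank $n_2-2$, that $(b_c)'(0)\,L_{N_2}^c\notin\operatorname{Im}(\underline{\overline{J}}{}_F^{N_2})$ and that $H\notin\operatorname{Im}(\underline{\overline{J}}{}_F^{N_2})$. Denote by $v\in\mathbb{R}^{n_2-1}$ a (nonzero) vector in the kernel of $\underline{\overline{J}}{}_F^{N_2}$. Then, generically, there exist $b_2^1,b_2^2:D_2\to\mathbb{R}^{n_2-1}$ such that $b^1=(b_1,b_c,b_2^1)$ and $b^2=(b_1,b_c,b_2^2)$, both maps $D_1\cap D_2\to\mathbb{R}^{n_1+n_2-1}$, are bifurcation branches for $F^N$. Furthermore, for any cell $d\in N_2$ such that $v_d\neq0$, the growth-rate of the bifurcation branches, $b^1_d$ and $b^2_d$, at cell $d$ is $\sqrt{|\lambda|}$.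
   Context: A (weighted, uniform) network $N$ with $n$ cells consists of a finite set $C$ of cells and a real weighted adjacency matrix $W_N=(w_{ij})$, where $w_{ij}$ is the weight of the edge from cell $j$ to cell $i$ ($0$ if there is no such edge; self-loops are allowed). Networks are assumed connected as undirected graphs. The input valency of cell $i$ is $v(i)=\sum_jw_{ij}$, $D_N$ is the diagonal matrix of input valencies, and the Laplacian is $L_N=D_N-W_N$. Coalescence: $N=N_1\circ N_2$ has cell set $C=C_1\cup C_2$ with $C_1\cap C_2=\{c\}$, and weights $w^N_{cc}=w^{N_1}_{cc}+w^{N_2}_{cc}$, and $w^N_{ab}=w^{N_i}_{ab}$ if $a,b\in C_i$ and $(a,b)\neq(c,c)$; all other weights are $0$. Cells are ordered so that $c$ is the last cell of $N_1$ and the first cell of $N_2$. $N$ is a feedforward coalescence network if, in $N_2$, the cell $c$ has no inputs from the other cells of $N_2$ (self-inputs are allowed). Given smooth $g:\mathbb{R}\times\mathbb{R}\to\mathbb{R}$ and $h:\mathbb{R}\times\mathbb{R}\times\mathbb{R}\to\mathbb{R}$, the admissible system $F^N$ of a network $N$ is $\dot x_i=f_i(x,\lambda)=g(x_i,\lambda)+\sum_jw_{ij}h(x_i,x_j,\lambda)$, with $\lambda\in\mathbb{R}$ the bifurcation parameter; $F^N,F^{N_1},F^{N_2}$ are defined by the same $g,h$. The system is diffusive if $h(z,z,\lambda)=0$ for all $z,\lambda$. With $g_0=\partial_xg$ and $h_1=\partial_{x_1}h$ at the origin, the Jacobian at the origin of a diffusive system of $N$ is $g_0\,\mathrm{id}+h_1L_N$;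 a bifurcation condition is $g_0+\mu h_1=0$ with $\mu$ an eigenvalue of $L_N$. Standing assumptions: the origin is an equilibrium for every $\lambda$; exactly one eigenvalue satisfies the bifurcation condition; and the bifurcation condition holds for both $N_1$ and $N_2$. "Generically" refers to generic $g$ and $h$. An equilibrium branch of $F^N$ is a map $b:D\to\mathbb{R}^n$ with $F^N(b(\lambda),\lambda)=0$ and $b(0)=0$, where $D$ has the form $]-\epsilon,\epsilon[$, $[0,\epsilon[$ or $]-\epsilon,0]$ for some $\epsilon>0$ ($D_1$ and $D_2$ are domains of such form); it is a bifurcation branch if $b\not\equiv0$. Notation: $L_{N_2}^c\in\mathbb{R}^{n_2-1}$ is the $c$-column of $L_{N_2}$ without the $c$-row; $\underline{\overline{J}}{}_F^{N_2}$ is the Jacobian at the origin of $F^{N_2}$ with the $c$-row and $c$-column removed; $H=\big(v^T\,\underline{\overline{H}}{}^{N_2}_{f_j}\,v\big)_{j\in C_2\setminus\{c\}}\in\mathbb{R}^{n_2-1}$, where $\underline{\overline{H}}{}^{N_2}_{f_j}$ is the Hessian matrix in $x$ at the origin of the component $f_j$ of $F^{N_2}$ with the $c$-row and $c$-column removed, and $v$ is a nonzero kernel vector of $\underline{\overline{J}}{}_F^{N_2}$ (unique up to scaling, which only rescales $H$). The coordinates of $v$ and of $b_2^1,b_2^2$ are indexed by the cells of $N_2$ other than $c$. Growth-rate $\sqrt{|\lambda|}$ means that the function is of order $\sqrt{|\lambda|}$ as $\lambda\to0$.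
   Formalization: A one-sided D_1 must lie on the side of λ=0 (fixed by N_2, g, h and b_c'(0)) where the new branches exist; on the other side D_1∩D_2={0} and the claim fails. Two-sided D_1 is fully covered. "Generically" is replaced by all smooth g, h meeting the stated conditions. *)

theory Defs
  imports "HOL-Analysis.Analysis" "HOL-Library.Landau_Symbols"
begin

section \<open>Smooth functions\<close>

primrec continuously_differentiable :: "nat \<Rightarrow> ('a::euclidean_space \<Rightarrow> real) \<Rightarrow> bool" where
  "continuously_differentiable 0 f \<longleftrightarrow> continuous_on UNIV f"
| "continuously_differentiable (Suc k) f \<longleftrightarrow>
     f differentiable_on UNIV \<and>
     (\<forall>e\<in>Basis. continuously_differentiable k (\<lambda>x. frechet_derivative f (at x) e))"

definition smooth :: "('a::euclidean_space \<Rightarrow> real) \<Rightarrow> bool" where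
  "smooth f \<longleftrightarrow> (\<forall>k. continuously_differentiable k f)"

definition hessian :: "(real^'n \<Rightarrow> real) \<Rightarrow> real^'n \<Rightarrow> real^'n^'n" where
  "hessian f x =
     (\<chi> i j. frechet_derivative (\<lambda>y. frechet_derivative f (at y) (axis j 1)) (at x) (axis i 1))"


section \<open>Weighted networks\<close>

text \<open>A network is given by its weighted adjacency matrix: \<open>W $ i $ j\<close> is the weight of the
  edge from cell \<open>j\<close> to cell \<open>i\<close>, and the cells are the elements of a finite type.\<close>

definition connected_network :: "real^'n^'n \<Rightarrow> bool" where
  "connected_network W \<longleftrightarrow> (\<forall>i j. (i, j) \<in> {(a, b). W $ a $ b \<noteq> 0 \<or> W $ b $ a \<noteq> 0}\<^sup>*)"

definition input_valency :: "real^'n^'n \<Rightarrow> 'n \<Rightarrow> real" where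
  "input_valency W i = (\<Sum>j\<in>UNIV. W $ i $ j)"

definition laplacian :: "real^'n^'n \<Rightarrow> real^'n^'n" where
  "laplacian W = (\<chi> i j. if i = j then input_valency W i else 0) - W"

definition eigenvalue :: "real^'n^'n \<Rightarrow> complex \<Rightarrow> bool" where
  "eigenvalue A \<mu> \<longleftrightarrow> (\<exists>x::complex^'n. x \<noteq> 0 \<and> map_matrix complex_of_real A *v x = \<mu> *s x)"


section \<open>Coalescence\<close>

text \<open>In \<open>N\<^sub>1 \<circ> N\<^sub>2\<close> the cells of \<open>N\<^sub>1\<close> form the type \<open>'p\<close>, with coalescence cell \<open>c :: 'p\<close>.
  The cells of \<open>N\<^sub>2\<close> form the type \<open>'q option\<close>, where \<open>None\<close> is the coalescence cell and
  \<open>'q\<close> consists of the other cells.  The cells of the coalescence form the type \<open>'p + 'q\<close>: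
  \<open>Inl i\<close> is the cell \<open>i\<close> of \<open>N\<^sub>1\<close>, \<open>Inr d\<close> is the cell \<open>Some d\<close> of \<open>N\<^sub>2\<close>, and \<open>None\<close> is
  identified with \<open>Inl c\<close>.\<close>

definition coalescence ::
    "'p::finite \<Rightarrow> real^'p^'p \<Rightarrow> real^('q::finite option)^('q option) \<Rightarrow> real^('p + 'q)^('p + 'q)" where
  "coalescence c W1 W2 = (\<chi> a b. case a of
      Inl i \<Rightarrow> (case b of
          Inl j \<Rightarrow> W1 $ i $ j + (if i = c \<and> j = c then W2 $ None $ None else 0)
        | Inr e \<Rightarrow> (if i = c then W2 $ None $ Some e else 0))
    | Inr d \<Rightarrow> (case b of
          Inl j \<Rightarrow> (if j = c then W2 $ Some d $ None else 0)
        | Inr e \<Rightarrow> W2 $ Some d $ Some e))"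

definition feedforward :: "real^('q::finite option)^('q option) \<Rightarrow> bool" where
  "feedforward W2 \<longleftrightarrow> (\<forall>d. W2 $ None $ Some d = 0)"

definition join :: "real^'p::finite \<Rightarrow> real^'q::finite \<Rightarrow> real^('p + 'q)" where
  "join x y = (\<chi> a. case a of Inl i \<Rightarrow> x $ i | Inr d \<Rightarrow> y $ d)"

text \<open>Removal of the row and the column of the coalescence cell, and the column of that cell
  without its own row.\<close>

definition without_c :: "real^('q::finite option)^('q option) \<Rightarrow> real^'q^'q" where
  "without_c A = (\<chi> d e. A $ Some d $ Some e)"

definition c_column :: "real^('q::finite option)^('q option) \<Rightarrow> real^'q" where
  "c_column A = (\<chi> d. A $ Some d $ None)"


section \<open>Admissible systems and bifurcation branches\<close>

definition admissible ::
    "(real \<times> real \<Rightarrow> real) \<Rightarrow> (real \<times> real \<times> real \<Rightarrow> real) \<Rightarrow> real^'n^'n \<Rightarrow>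
     real^'n \<Rightarrow> real \<Rightarrow> real^'n" where
  "admissible g h W x l =
     (\<chi> i. g (x $ i, l) + (\<Sum>j\<in>UNIV. W $ i $ j * h (x $ i, x $ j, l)))"

definition diffusive :: "(real \<times> real \<times> real \<Rightarrow> real) \<Rightarrow> bool" where
  "diffusive h \<longleftrightarrow> (\<forall>z l. h (z, z, l) = 0)"

definition bifurcation_condition ::
    "(real \<times> real \<Rightarrow> real) \<Rightarrow> (real \<times> real \<times> real \<Rightarrow> real) \<Rightarrow> complex \<Rightarrow> bool" where
  "bifurcation_condition g h \<mu> \<longleftrightarrow>
     complex_of_real (deriv (\<lambda>x. g (x, 0)) 0) +
       \<mu> * complex_of_real (deriv (\<lambda>x. h (x, 0, 0)) 0) = 0"

definition jacobian_origin :: "(real^'n \<Rightarrow> real \<Rightarrow> real^'n) \<Rightarrow> real^'n^'n" where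
  "jacobian_origin F = jacobian (\<lambda>x. F x 0) (at 0)"

definition hessian_vector ::
    "(real^('q::finite option) \<Rightarrow> real \<Rightarrow> real^('q option)) \<Rightarrow> real^'q \<Rightarrow> real^'q" where
  "hessian_vector F v =
     (\<chi> d. v \<bullet> (without_c (hessian (\<lambda>x. F x 0 $ Some d) 0) *v v))"

definition branch_domain :: "real set \<Rightarrow> bool" where
  "branch_domain D \<longleftrightarrow> (\<exists>\<epsilon>>0. D = {-\<epsilon><..<\<epsilon>} \<or> D = {0..<\<epsilon>} \<or> D = {-\<epsilon><..0})"

definition equilibrium_branch ::
    "(real^'n \<Rightarrow> real \<Rightarrow> real^'n) \<Rightarrow> real set \<Rightarrow> (real \<Rightarrow> real^'n) \<Rightarrow> bool" where
  "equilibrium_branch F D b \<longleftrightarrow> branch_domain D \<and> (\<forall>l\<in>D. F (b l) l = 0) \<and> b 0 = 0"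

definition bifurcation_branch ::
    "(real^'n \<Rightarrow> real \<Rightarrow> real^'n) \<Rightarrow> real set \<Rightarrow> (real \<Rightarrow> real^'n) \<Rightarrow> bool" where
  "bifurcation_branch F D b \<longleftrightarrow> equilibrium_branch F D b \<and> (\<exists>l\<in>D. b l \<noteq> 0)"

text \<open>Two conventions for statements about branches of a coalescence.

  Genericity: the exact non-degeneracy conditions are stated as hypotheses, for arbitrary smooth
  \<open>g\<close> and \<open>h\<close>.  The condition \<open>h\<^sub>1 \<noteq> 0\<close> need not be listed.  If \<open>h\<^sub>1 = 0\<close>, a bifurcation condition
  forces \<open>g\<^sub>0 = 0\<close>, so the Jacobian vanishes and rank \<open>n\<^sub>2 - 2\<close> means \<open>n\<^sub>2 = 2\<close>; then \<open>0\<close> and the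
  (nonzero) weight of the edge leaving the coalescence cell are two eigenvalues of the Laplacian
  of the coalescence that satisfy the bifurcation condition, against uniqueness.

  Side of the bifurcation: a branch growing like \<open>\<surd>|\<lambda>|\<close> lives on one side of \<open>\<lambda> = 0\<close>, and which
  side is determined by \<open>N\<^sub>2\<close>, \<open>g\<close>, \<open>h\<close> and \<open>b\<^sub>c'(0)\<close>.  A branch of \<open>N\<^sub>1\<close> whose domain \<open>D\<^sub>1\<close> lies
  entirely on the other side gives \<open>D\<^sub>1 \<inter> D\<^sub>2 = {0}\<close>, which is not a branch domain; such \<open>D\<^sub>1\<close>
  have to be excluded, whereas a two-sided \<open>D\<^sub>1\<close> meets either side.\<close>

end

theory Submission
  imports Defs
begin

text \<open>Since \<open>c\<close> has no inputs from \<open>N\<^sub>2\<close>, a branch of \<open>N\<^sub>1\<close> extends to \<open>N\<close> as soon as the cells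
  \<open>y\<close> of \<open>N\<^sub>2\<close> other than \<open>c\<close> solve \<open>G(y, b\<^sub>c(\<lambda>), \<lambda>) = 0\<close>.  Taylor's formula with integral remainder
  writes \<open>G(x) = A x + R(x)(x)\<close>, with \<open>A\<close> linear and \<open>R(x)\<close> a quadratic map depending continuously
  on \<open>x\<close>.  Let \<open>r = \<surd>|\<lambda>|\<close>, let \<open>a\<close> be a linear functional with \<open>a(v) = 1\<close> and let
  \<open>P = (a(u) v, 0) + r (u, m)\<close>.  As \<open>A\<close> annihilates \<open>(v, 0)\<close>, we have
  \<open>G(r P) = r\<^sup>2 (A (u, m) + R(r P)(P))\<close>, and the second factor is continuous up to \<open>r = 0\<close>.  There it
  equals \<open>J u + A (0, m) + a(u)\<^sup>2 H / 2\<close>, where \<open>m\<close> tends to \<open>\<plusminus>(b\<^sub>c'(0), 1)\<close>.  As \<open>J\<close> has corank one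
  and neither \<open>b\<^sub>c'(0) L\<^sup>c\<close> nor \<open>H\<close> lies in its image, for exactly one sign of \<open>\<lambda>\<close> this limit has
  zeros; they have \<open>a(u) = \<plusminus>\<alpha> \<noteq> 0\<close>, and the derivative in \<open>u\<close> is invertible there.  Brouwer's fixed
  point theorem continues them to small \<open>r\<close> without any regularity of \<open>b\<^sub>c\<close> beyond differentiability
  at \<open>0\<close>, and \<open>y = \<plusminus>\<alpha> r v + o(r)\<close> is the growth rate.\<close>


section \<open>Zeros of perturbed maps\<close>

lemma brouwer_zero_near_isomorphism:
  fixes f :: "'a::euclidean_space \<Rightarrow> 'a"
  assumes cont: "continuous_on (cball a r) f" and "0 \<le> r"
    and L: "linear L" and L': "linear L'" and inverse: "\<And>x. L' (L x) = x" "\<And>x. L (L' x) = x"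
    and bound: "\<And>x. norm (L' x) \<le> K * norm x" and "0 < K"
    and near: "\<And>x. x \<in> cball a r \<Longrightarrow> norm (f x - L (x - a)) \<le> r / K"
  obtains x where "x \<in> cball a r" "f x = 0"
proof -
  define \<phi> where "\<phi> x = x - L' (f x)" for x
  have "continuous_on (cball a r) \<phi>"
    unfolding \<phi>_def by (intro continuous_intros linear_continuous_on_compose[OF cont L'])
  moreover have "\<phi> \<in> cball a r \<rightarrow> cball a r"
  proof
    fix x assume x: "x \<in> cball a r"
    have "\<phi> x - a = - L' (f x - L (x - a))"
      by (simp add: \<phi>_def linear_diff[OF L'] inverse)
    then have "norm (\<phi> x - a) \<le> K * norm (f x - L (x - a))"
      by (simp add: bound)
    also have "\<dots> \<le> r"
      using near[OF x] \<open>0 < K\<close> by (simp add: pos_le_divide_eq mult.commute)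
    finally show "\<phi> x \<in> cball a r" by (simp add: dist_norm norm_minus_commute)
  qed
  ultimately obtain x where x: "x \<in> cball a r" "\<phi> x = x"
    using brouwer[of "cball a r" \<phi>] \<open>0 \<le> r\<close> by auto
  from x(2) have "L' (f x) = 0" by (simp add: \<phi>_def)
  then have "f x = 0" using inverse(2)[of "f x"] linear_0[OF L] by simp
  with x(1) show thesis by (rule that)
qed

lemma eventually_zero_in_cball:
  fixes f :: "'p::topological_space \<Rightarrow> 'a::euclidean_space \<Rightarrow> 'a"
  assumes cont: "continuous_on (P \<times> U) (\<lambda>(p, x). f p x)"
    and P: "open P" "p\<^sub>0 \<in> P" and U: "open U" "x\<^sub>0 \<in> U" and zero: "f p\<^sub>0 x\<^sub>0 = 0"
    and der: "(f p\<^sub>0 has_derivative L) (at x\<^sub>0)" and surj: "surj L" and "\<epsilon> > 0"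
  shows "\<forall>\<^sub>F p in nhds p\<^sub>0. \<exists>x\<in>cball x\<^sub>0 \<epsilon>. f p x = 0"
proof -
  have L: "linear L" by (rule has_derivative_linear[OF der])
  obtain L' where L': "linear L'" "\<And>x. L' (L x) = x" "\<And>x. L (L' x) = x"
    using linear_surjective_isomorphism[OF L surj] by auto
  obtain K where K: "K > 0" "\<And>x. norm (L' x) \<le> K * norm x"
    using linear_bounded_pos[OF L'(1)] by auto
  obtain d where d: "d > 0"
    "\<And>x. norm (x - x\<^sub>0) < d \<Longrightarrow> norm (f p\<^sub>0 x - L (x - x\<^sub>0)) \<le> 1 / (2 * K) * norm (x - x\<^sub>0)"
    using der K(1) zero unfolding has_derivative_at_alt by (auto dest!: spec[of _ "1 / (2 * K)"])
  obtain e where e: "e > 0" "cball x\<^sub>0 e \<subseteq> U" using U open_contains_cball by blast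
  define r where "r = min \<epsilon> (min e (d / 2))"
  have r: "0 < r" "r \<le> \<epsilon>" "r < d" using \<open>\<epsilon> > 0\<close> e(1) d(1) by (auto simp: r_def)
  have ball: "cball x\<^sub>0 r \<subseteq> U" using e(2) by (auto simp: r_def)
  have cont_ball: "continuous_on (P \<times> cball x\<^sub>0 r) (\<lambda>(p, x). f p x)"
    by (rule continuous_on_subset[OF cont]) (use ball in auto)
  have tolerance: "0 < r / (2 * K)" using r(1) K(1) by simp
  obtain V where V: "p\<^sub>0 \<in> V" "open V"
    and close: "\<forall>p\<in>V \<inter> P. \<forall>x\<in>cball x\<^sub>0 r. dist (f p x) (f p\<^sub>0 x) \<le> r / (2 * K)"
    by (rule continuous_on_prod_compactE[OF cont_ball compact_cball P(2) tolerance,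
          unfolded prod.case])
  have "\<exists>x\<in>cball x\<^sub>0 \<epsilon>. f p x = 0" if p: "p \<in> V \<inter> P" for p
  proof (rule brouwer_zero_near_isomorphism[OF _ _ L L' K(2,1)])
    show "continuous_on (cball x\<^sub>0 r) (f p)"
      by (rule continuous_on_compose2[OF cont_ball, of _ "Pair p", simplified])
        (use p in \<open>auto intro!: continuous_intros\<close>)
    show "norm (f p x - L (x - x\<^sub>0)) \<le> r / K" if x: "x \<in> cball x\<^sub>0 r" for x
    proof -
      have "norm (x - x\<^sub>0) \<le> r" using x by (simp add: dist_norm norm_minus_commute)
      then have "norm (f p\<^sub>0 x - L (x - x\<^sub>0)) \<le> 1 / (2 * K) * r"
        using r(3) K(1) by (intro order_trans[OF d(2)] mult_left_mono) auto
      moreover have "norm (f p x - f p\<^sub>0 x) \<le> r / (2 * K)"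
        using close p x by (simp add: dist_norm)
      ultimately have "norm (f p x - L (x - x\<^sub>0)) \<le> r / (2 * K) + 1 / (2 * K) * r"
        by (rule norm_diff_triangle_le[rotated])
      then show ?thesis by simp
    qed
  qed (use r in auto)
  then show ?thesis unfolding eventually_nhds using V P by (intro exI[of _ "V \<inter> P"]) auto
qed

lemma tendsto_closest_point:
  fixes Z :: "'p \<Rightarrow> 'a::{real_inner, heine_borel} set"
  assumes closed: "\<forall>\<^sub>F p in F. closed (Z p)"
    and near: "\<And>\<epsilon>. \<epsilon> > 0 \<Longrightarrow> \<forall>\<^sub>F p in F. \<exists>z\<in>Z p. dist a z \<le> \<epsilon>"
  shows "((\<lambda>p. closest_point (Z p) a) \<longlongrightarrow> a) F"
proof (rule tendstoI)
  fix e :: real assume "e > 0"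
  from closed near[OF half_gt_zero[OF this]]
  show "\<forall>\<^sub>F p in F. dist (closest_point (Z p) a) a < e"
  proof eventually_elim
    case (elim p)
    then obtain z where "z \<in> Z p" "dist a z \<le> e / 2" by blast
    with closest_point_le[OF elim(1) this(1), of a] \<open>e > 0\<close> show ?case by (simp add: dist_commute)
  qed
qed

theorem implicit_function_at_point:
  fixes f :: "'p::topological_space \<Rightarrow> 'a::euclidean_space \<Rightarrow> 'a"
  assumes cont: "continuous_on (P \<times> U) (\<lambda>(p, x). f p x)"
    and P: "open P" "p\<^sub>0 \<in> P" and U: "open U" "x\<^sub>0 \<in> U" and zero: "f p\<^sub>0 x\<^sub>0 = 0"
    and der: "(f p\<^sub>0 has_derivative L) (at x\<^sub>0)" and surj: "surj L"
  obtains x where "(x \<longlongrightarrow> x\<^sub>0) (nhds p\<^sub>0)" "\<forall>\<^sub>F p in nhds p\<^sub>0. f p (x p) = 0"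
proof -
  obtain r where r: "r > 0" "cball x\<^sub>0 r \<subseteq> U" using U open_contains_cball by blast
  define Z where "Z p = {x \<in> cball x\<^sub>0 r. f p x = 0}" for p
  have "closed (Z p)" if "p \<in> P" for p
  proof -
    have "continuous_on (cball x\<^sub>0 r) (f p)"
      by (rule continuous_on_compose2[OF cont, of _ "Pair p", simplified])
        (use that r(2) in \<open>auto intro!: continuous_intros\<close>)
    then show ?thesis
      unfolding Z_def by (rule continuous_closed_preimage_constant) simp
  qed
  then have closed: "\<forall>\<^sub>F p in nhds p\<^sub>0. closed (Z p)"
    using eventually_nhds_in_open[OF P] by (auto elim: eventually_mono)
  have near: "\<forall>\<^sub>F p in nhds p\<^sub>0. \<exists>z\<in>Z p. dist x\<^sub>0 z \<le> \<epsilon>" if "\<epsilon> > 0" for \<epsilon>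
  proof -
    have "\<forall>\<^sub>F p in nhds p\<^sub>0. \<exists>x\<in>cball x\<^sub>0 (min r \<epsilon>). f p x = 0"
      by (rule eventually_zero_in_cball[OF assms]) (use r(1) that in simp)
    then show ?thesis by eventually_elim (auto simp: Z_def)
  qed
  show thesis
  proof
    show "((\<lambda>p. closest_point (Z p) x\<^sub>0) \<longlongrightarrow> x\<^sub>0) (nhds p\<^sub>0)"
      using closed near by (rule tendsto_closest_point)
    from closed near[OF zero_less_one]
    show "\<forall>\<^sub>F p in nhds p\<^sub>0. f p (closest_point (Z p) x\<^sub>0) = 0"
    proof eventually_elim
      case (elim p)
      then have "closest_point (Z p) x\<^sub>0 \<in> Z p" by (intro closest_point_in_set) auto
      then show ?case by (simp add: Z_def)
    qed
  qed
qed


section \<open>Blow-up of a quadratic degeneracy of corank one\<close>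

lemma scaleR_mem_range_iff:
  assumes "linear f" and "r \<noteq> 0"
  shows "r *\<^sub>R x \<in> range f \<longleftrightarrow> x \<in> range f"
proof -
  have subspace: "subspace (range f)" by (simp add: linear_subspace_image[OF assms(1)])
  show ?thesis
    using subspace_scale[OF subspace, of x r] subspace_scale[OF subspace, of "r *\<^sub>R x" "1 / r"]
      assms(2)
    by auto
qed

lemma span_insert_range_corank_one:
  fixes A :: "real^'n^'n"
  assumes "rank A = CARD('n) - 1" and "x \<notin> range ((*v) A)"
  shows "span (insert x (range ((*v) A))) = UNIV"
proof -
  have span: "span (range ((*v) A)) = range ((*v) A)" by (simp add: linear_subspace_image)
  have "dim (insert x (range ((*v) A))) = dim (range ((*v) A)) + 1"
    using assms(2) by (simp only: dim_insert span if_False)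
  also have "\<dots> = DIM(real^'n)"
    using assms(1) zero_less_card_finite[where 'a='n] by (simp add: rank_dim_range)
  finally show ?thesis using dim_eq_full by blast
qed

lemma span_insert_range_decomposition:
  assumes "linear A" and "span (insert q (range A)) = UNIV"
  obtains z t where "x = A z + t *\<^sub>R q"
proof -
  have span_range: "span (range A) = range A"
    by (simp add: linear_subspace_image[OF assms(1)])
  have "x \<in> span (insert q (range A))" using assms(2) by simp
  then obtain t z where "x - t *\<^sub>R q = A z" unfolding span_insert span_range by auto
  then show thesis by (intro that[of z t]) (simp add: algebra_simps)
qed

lemma surj_corank_one_perturbation:
  fixes A :: "'a::real_vector \<Rightarrow> 'b::real_vector" and a :: "'a \<Rightarrow> real"
  assumes A: "linear A" "A v = 0" and a: "linear a" "a v = 1"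
    and span: "span (insert q (range A)) = UNIV" and "t \<noteq> 0"
  shows "surj (\<lambda>u. A u + (t * a u) *\<^sub>R q)"
proof -
  have "\<exists>u. x = A u + (t * a u) *\<^sub>R q" for x
  proof -
    obtain z s where x: "x = A z + s *\<^sub>R q"
      by (rule span_insert_range_decomposition[OF A(1) span])
    define u where "u = z + (s / t - a z) *\<^sub>R v"
    have "A u = A z" "a u = s / t"
      by (simp_all add: u_def linear_add linear_scale A a)
    then show ?thesis using x \<open>t \<noteq> 0\<close> by (intro exI[of _ u]) simp
  qed
  then show ?thesis by (auto simp: surj_def)
qed

lemma corank_one_quadratic_zeros:
  fixes A :: "'a::real_vector \<Rightarrow> 'b::real_vector" and a :: "'a \<Rightarrow> real"
  assumes A: "linear A" "A v = 0" and a: "linear a" "a v = 1"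
    and span: "span (insert q (range A)) = UNIV" and b: "b \<notin> range A"
  obtains \<sigma> \<alpha> :: real where "\<sigma> \<in> {1, -1}" "\<alpha> > 0"
    "\<And>\<tau>. \<tau> \<in> {1, -1} \<Longrightarrow> \<exists>u. a u = \<tau> * \<alpha> \<and> A u + \<sigma> *\<^sub>R b + (a u)\<^sup>2 *\<^sub>R q = 0"
proof -
  obtain z t where bzt: "b = A z + t *\<^sub>R q"
    by (rule span_insert_range_decomposition[OF A(1) span])
  with b have "t \<noteq> 0" by auto
  define \<sigma> \<alpha> where "\<sigma> = - sgn t" and "\<alpha> = sqrt \<bar>t\<bar>"
  have "\<exists>u. a u = \<tau> * \<alpha> \<and> A u + \<sigma> *\<^sub>R b + (a u)\<^sup>2 *\<^sub>R q = 0" if "\<tau> \<in> {1, -1}" for \<tau>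
  proof -
    define u where "u = (\<tau> * \<alpha> + \<sigma> * a z) *\<^sub>R v - \<sigma> *\<^sub>R z"
    have au: "a u = \<tau> * \<alpha>" and Au: "A u = - (\<sigma> *\<^sub>R A z)"
      by (simp_all add: u_def linear_diff linear_scale A a)
    have "(a u)\<^sup>2 + \<sigma> * t = 0"
      using that unfolding au by (auto simp: \<alpha>_def \<sigma>_def power_mult_distrib abs_if sgn_if)
    moreover have "A u + \<sigma> *\<^sub>R b + (a u)\<^sup>2 *\<^sub>R q = ((a u)\<^sup>2 + \<sigma> * t) *\<^sub>R q"
      by (simp add: Au bzt algebra_simps)
    ultimately show ?thesis using au by auto
  qed
  moreover have "\<sigma> \<in> {1, -1}" "\<alpha> > 0"
    using \<open>t \<noteq> 0\<close> by (auto simp: \<sigma>_def \<alpha>_def sgn_real_def)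
  ultimately show thesis using that by blast
qed

lemma one_sided_difference_quotient:
  fixes p :: "real \<Rightarrow> 'b::real_normed_vector"
  assumes \<sigma>: "\<sigma> \<in> {1, -1 :: real}" and D: "D \<subseteq> {l. 0 \<le> \<sigma> * l}" and "p 0 = 0"
    and p: "(p has_vector_derivative w) (at 0 within D)"
  shows "((\<lambda>l. p l /\<^sub>R \<bar>l\<bar>) \<longlongrightarrow> \<sigma> *\<^sub>R w) (at 0 within D)"
proof -
  have "((\<lambda>l. (1 / \<bar>l\<bar>) *\<^sub>R (p l - l *\<^sub>R w)) \<longlongrightarrow> 0) (at 0 within D)"
    using p \<open>p 0 = 0\<close> by (simp add: has_vector_derivative_def has_derivative_within)
  moreover have "\<forall>\<^sub>F l in at 0 within D. (1 / \<bar>l\<bar>) *\<^sub>R (p l - l *\<^sub>R w) = p l /\<^sub>R \<bar>l\<bar> - \<sigma> *\<^sub>R w"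
    unfolding eventually_at_filter
  proof (rule always_eventually, intro allI impI)
    fix l assume "l \<noteq> 0" "l \<in> D"
    then have "\<bar>l\<bar> = \<sigma> * l" using \<sigma> D by auto
    then have "l / \<bar>l\<bar> = \<sigma>" using \<sigma> \<open>l \<noteq> 0\<close> by auto
    then show "(1 / \<bar>l\<bar>) *\<^sub>R (p l - l *\<^sub>R w) = p l /\<^sub>R \<bar>l\<bar> - \<sigma> *\<^sub>R w"
      by (simp add: scaleR_diff_right divide_inverse_commute)
  qed
  ultimately have "((\<lambda>l. p l /\<^sub>R \<bar>l\<bar> - \<sigma> *\<^sub>R w) \<longlongrightarrow> 0) (at 0 within D)"
    by (rule Lim_transform_eventually)
  then show ?thesis by (rule LIM_zero_cancel)
qed

lemma eventually_neq_of_scaled_limits: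
  fixes y z :: "'a \<Rightarrow> 'b::real_normed_vector"
  assumes "((\<lambda>l. y l /\<^sub>R r l) \<longlongrightarrow> a) F" and "((\<lambda>l. z l /\<^sub>R r l) \<longlongrightarrow> b) F" and "a \<noteq> b"
  shows "\<forall>\<^sub>F l in F. y l \<noteq> z l"
proof -
  have "((\<lambda>l. y l /\<^sub>R r l - z l /\<^sub>R r l) \<longlongrightarrow> a - b) F" using assms(1,2) by (rule tendsto_diff)
  then have "\<forall>\<^sub>F l in F. y l /\<^sub>R r l - z l /\<^sub>R r l \<noteq> 0"
    by (rule tendsto_imp_eventually_ne) (use assms(3) in simp)
  then show ?thesis by eventually_elim auto
qed

lemma bigtheta_component_of_scaled_limit:
  fixes y :: "'a \<Rightarrow> real^'n"
  assumes limit: "((\<lambda>l. y l /\<^sub>R r l) \<longlongrightarrow> w) F" and "w $ d \<noteq> 0" and "\<forall>\<^sub>F l in F. r l \<noteq> 0"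
  shows "(\<lambda>l. y l $ d) \<in> \<Theta>[F](r)"
proof (rule bigthetaI_tendsto)
  show "((\<lambda>l. y l $ d / r l) \<longlongrightarrow> w $ d) F"
    using tendsto_vec_nth[OF limit, of d] by (simp add: divide_inverse_commute)
qed (use assms in auto)

definition square_root_branch ::
    "('a::real_normed_vector \<times> 'b \<Rightarrow> 'c::zero) \<Rightarrow> (real \<Rightarrow> 'b) \<Rightarrow> real set \<Rightarrow> 'a \<Rightarrow>
     (real \<Rightarrow> 'a) \<Rightarrow> bool" where
  "square_root_branch G p D w y \<longleftrightarrow> y 0 = 0 \<and>
     (\<forall>\<^sub>F l in at 0 within D. G (y l, p l) = 0) \<and>
     ((\<lambda>l. y l /\<^sub>R sqrt \<bar>l\<bar>) \<longlongrightarrow> w) (at 0 within D)"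

locale quadratic_expansion =
  fixes G :: "'a::euclidean_space \<times> 'b::euclidean_space \<Rightarrow> 'a"
    and A :: "'a \<times> 'b \<Rightarrow> 'a" and R :: "'a \<times> 'b \<Rightarrow> 'a \<times> 'b \<Rightarrow> 'a" and v :: 'a
  assumes linear_A: "linear A"
    and continuous_R: "continuous_on UNIV (\<lambda>(x, q). R x q)"
    and R_scaleR: "R x (r *\<^sub>R q) = r\<^sup>2 *\<^sub>R R x q"
    and expansion: "G x = A x + R x x"
    and kernel: "A (v, 0) = 0" "v \<noteq> 0"
begin

definition kernel_coordinate :: "'a \<Rightarrow> real" where
  "kernel_coordinate u = (u \<bullet> v) / (v \<bullet> v)"

definition blow_up_point :: "real \<Rightarrow> 'b \<Rightarrow> 'a \<Rightarrow> 'a \<times> 'b" where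
  "blow_up_point r m u = (kernel_coordinate u *\<^sub>R v, 0) + r *\<^sub>R (u, m)"

definition blown_up :: "real \<times> 'b \<Rightarrow> 'a \<Rightarrow> 'a" where
  "blown_up = (\<lambda>(r, m) u. A (u, m) + R (r *\<^sub>R blow_up_point r m u) (blow_up_point r m u))"

lemma linear_kernel_coordinate: "linear kernel_coordinate"
  by (rule linearI) (simp_all add: kernel_coordinate_def inner_add_left add_divide_distrib)

lemma kernel_coordinate_v: "kernel_coordinate v = 1"
  using kernel(2) by (simp add: kernel_coordinate_def)

lemma linear_A_fst: "linear (\<lambda>u. A (u, 0))"
  by (rule linearI) (simp_all flip: linear_add[OF linear_A] linear_scale[OF linear_A])

lemma continuous_on_kernel_coordinate [continuous_intros]:
  "continuous_on S f \<Longrightarrow> continuous_on S (\<lambda>x. kernel_coordinate (f x))"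
  unfolding kernel_coordinate_def using kernel(2) by (intro continuous_intros) auto

lemma blow_up: "G (r *\<^sub>R blow_up_point r m u) = r\<^sup>2 *\<^sub>R blown_up (r, m) u"
proof -
  have "r *\<^sub>R blow_up_point r m u = (r * kernel_coordinate u) *\<^sub>R (v, 0) + r\<^sup>2 *\<^sub>R (u, m)"
    by (simp add: blow_up_point_def scaleR_add_right power2_eq_square)
  then have "A (r *\<^sub>R blow_up_point r m u) = r\<^sup>2 *\<^sub>R A (u, m)"
    by (simp only: linear_add[OF linear_A] linear_scale[OF linear_A] kernel) simp
  then show ?thesis by (simp add: expansion blown_up_def R_scaleR scaleR_add_right)
qed

lemma blown_up_0:
  "blown_up (0, m) u = A (u, 0) + A (0, m) + (kernel_coordinate u)\<^sup>2 *\<^sub>R R 0 (v, 0)"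
proof -
  have "A (u, m) = A (u, 0) + A (0, m)" by (simp flip: linear_add[OF linear_A])
  moreover have "blow_up_point 0 m u = kernel_coordinate u *\<^sub>R (v, 0)"
    by (simp add: blow_up_point_def)
  ultimately show ?thesis by (simp add: blown_up_def R_scaleR del: scaleR_Pair)
qed

lemma continuous_on_blown_up: "continuous_on (UNIV \<times> UNIV) (\<lambda>(p, u). blown_up p u)"
proof -
  have "continuous_on UNIV (\<lambda>x :: (real \<times> 'b) \<times> 'a. A (snd x, snd (fst x)))"
    by (intro linear_continuous_on_compose[OF _ linear_A] continuous_intros)
  moreover have "continuous_on UNIV (\<lambda>x :: (real \<times> 'b) \<times> 'a.
      let q = blow_up_point (fst (fst x)) (snd (fst x)) (snd x) in R (fst (fst x) *\<^sub>R q) q)"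
    unfolding blow_up_point_def Let_def
    by (rule continuous_on_compose2[OF continuous_R, of _ "\<lambda>x. (_ x, _ x)", simplified])
      (intro continuous_intros)
  ultimately show ?thesis
    by (simp add: blown_up_def case_prod_unfold Let_def continuous_on_add)
qed

lemma blown_up_0_has_derivative:
  "(blown_up (0, m) has_derivative
     (\<lambda>u. A (u, 0) + (2 * kernel_coordinate u\<^sub>0 * kernel_coordinate u) *\<^sub>R R 0 (v, 0))) (at u\<^sub>0)"
proof -
  have "((\<lambda>u. A (u, 0)) has_derivative (\<lambda>u. A (u, 0))) (at u\<^sub>0)"
    "(kernel_coordinate has_derivative kernel_coordinate) (at u\<^sub>0)"
    using linear_A_fst linear_kernel_coordinate
    by (auto intro: linear_imp_has_derivative simp: linear_conv_bounded_linear)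
  then show ?thesis
    unfolding blown_up_0[abs_def] by (auto intro!: derivative_eq_intros simp: mult_ac)
qed

lemma branch_of_blown_up_zero:
  assumes span: "span (insert (R 0 (v, 0)) (range (\<lambda>u. A (u, 0)))) = UNIV"
    and zero: "blown_up (0, m) u\<^sub>0 = 0" and nondegenerate: "kernel_coordinate u\<^sub>0 \<noteq> 0"
    and p: "((\<lambda>l. p l /\<^sub>R \<bar>l\<bar>) \<longlongrightarrow> m) (at 0 within D)"
  shows "\<exists>y. square_root_branch G p D (kernel_coordinate u\<^sub>0 *\<^sub>R v) y"
proof -
  have surj: "surj (\<lambda>u. A (u, 0) + (2 * kernel_coordinate u\<^sub>0 * kernel_coordinate u) *\<^sub>R R 0 (v, 0))"
    by (rule surj_corank_one_perturbation[OF linear_A_fst kernel(1) linear_kernel_coordinate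
          kernel_coordinate_v span]) (use nondegenerate in simp)
  obtain u where u: "(u \<longlongrightarrow> u\<^sub>0) (nhds (0, m))"
    and solves: "\<forall>\<^sub>F \<theta> in nhds (0, m). blown_up \<theta> (u \<theta>) = 0"
    by (rule implicit_function_at_point[OF continuous_on_blown_up open_UNIV UNIV_I open_UNIV UNIV_I
          zero blown_up_0_has_derivative surj])
  define \<theta> where "\<theta> l = (sqrt \<bar>l\<bar>, p l /\<^sub>R \<bar>l\<bar>)" for l :: real
  define q where "q l = kernel_coordinate (u (\<theta> l)) *\<^sub>R v + sqrt \<bar>l\<bar> *\<^sub>R u (\<theta> l)" for l
  define y where "y l = sqrt \<bar>l\<bar> *\<^sub>R q l" for l
  have sqrt: "((\<lambda>l. sqrt \<bar>l\<bar>) \<longlongrightarrow> 0) (at 0 within D)"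
    by (rule tendsto_eq_intros refl | simp)+
  then have \<theta>: "(\<theta> \<longlongrightarrow> (0, m)) (at 0 within D)"
    unfolding \<theta>_def using p by (rule tendsto_Pair)
  have nonzero: "\<forall>\<^sub>F l in at 0 within D. l \<noteq> 0" by (simp add: eventually_at_filter)
  have "square_root_branch G p D (kernel_coordinate u\<^sub>0 *\<^sub>R v) y"
    unfolding square_root_branch_def
  proof (intro conjI)
    show "y 0 = 0" by (simp add: y_def)
    show "\<forall>\<^sub>F l in at 0 within D. G (y l, p l) = 0"
      using eventually_compose_filterlim[OF solves \<theta>] nonzero
    proof eventually_elim
      case (elim l)
      have "(y l, p l) = sqrt \<bar>l\<bar> *\<^sub>R blow_up_point (sqrt \<bar>l\<bar>) (p l /\<^sub>R \<bar>l\<bar>) (u (\<theta> l))"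
        using elim(2) by (simp add: y_def q_def blow_up_point_def flip: mult.assoc)
      then show ?case using elim(1) by (simp only: blow_up) (simp add: \<theta>_def)
    qed
    have "((\<lambda>l. u (\<theta> l)) \<longlongrightarrow> u\<^sub>0) (at 0 within D)" by (rule filterlim_compose[OF u \<theta>])
    then have "(q \<longlongrightarrow> kernel_coordinate u\<^sub>0 *\<^sub>R v + 0 *\<^sub>R u\<^sub>0) (at 0 within D)"
      unfolding q_def kernel_coordinate_def
      using kernel(2) by (intro tendsto_intros sqrt) auto
    then have "(q \<longlongrightarrow> kernel_coordinate u\<^sub>0 *\<^sub>R v) (at 0 within D)" by simp
    moreover have "\<forall>\<^sub>F l in at 0 within D. q l = y l /\<^sub>R sqrt \<bar>l\<bar>"
      using nonzero by eventually_elim (simp add: y_def)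
    ultimately show "((\<lambda>l. y l /\<^sub>R sqrt \<bar>l\<bar>) \<longlongrightarrow> kernel_coordinate u\<^sub>0 *\<^sub>R v) (at 0 within D)"
      by (rule Lim_transform_eventually)
  qed
  then show ?thesis by blast
qed

theorem fold_branches:
  assumes span: "span (insert (R 0 (v, 0)) (range (\<lambda>u. A (u, 0)))) = UNIV"
    and w: "A (0, w) \<notin> range (\<lambda>u. A (u, 0))"
  obtains \<sigma> \<alpha> :: real where "\<sigma> \<in> {1, -1}" "\<alpha> > 0"
    "\<And>D p. D \<subseteq> {l. 0 \<le> \<sigma> * l} \<Longrightarrow> p 0 = 0 \<Longrightarrow> (p has_vector_derivative w) (at 0 within D) \<Longrightarrow>
      \<exists>y y'. square_root_branch G p D (\<alpha> *\<^sub>R v) y \<and> square_root_branch G p D (- \<alpha> *\<^sub>R v) y'"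
proof -
  obtain \<sigma> \<alpha> :: real where \<sigma>: "\<sigma> \<in> {1, -1}" and \<alpha>: "\<alpha> > 0"
    and zeros: "\<And>\<tau>. \<tau> \<in> {1, -1} \<Longrightarrow> \<exists>u. kernel_coordinate u = \<tau> * \<alpha> \<and>
      A (u, 0) + \<sigma> *\<^sub>R A (0, w) + (kernel_coordinate u)\<^sup>2 *\<^sub>R R 0 (v, 0) = 0"
    by (rule corank_one_quadratic_zeros[OF linear_A_fst kernel(1) linear_kernel_coordinate
          kernel_coordinate_v span w]) blast
  have scale_w: "A (0, \<sigma> *\<^sub>R w) = \<sigma> *\<^sub>R A (0, w)" by (simp flip: linear_scale[OF linear_A])
  show thesis
  proof (rule that[OF \<sigma> \<alpha>])
    fix D p
    assume D: "D \<subseteq> {l. 0 \<le> \<sigma> * l}" and "p 0 = 0"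
      and "(p has_vector_derivative w) (at 0 within D)"
    then have p: "((\<lambda>l. p l /\<^sub>R \<bar>l\<bar>) \<longlongrightarrow> \<sigma> *\<^sub>R w) (at 0 within D)"
      by (intro one_sided_difference_quotient \<sigma>)
    have "\<exists>y. square_root_branch G p D ((\<tau> * \<alpha>) *\<^sub>R v) y" if \<tau>: "\<tau> \<in> {1, -1}" for \<tau>
    proof -
      obtain u where u: "kernel_coordinate u = \<tau> * \<alpha>" "blown_up (0, \<sigma> *\<^sub>R w) u = 0"
        using zeros[OF \<tau>] by (auto simp: blown_up_0 scale_w)
      then have "kernel_coordinate u \<noteq> 0" using \<tau> \<alpha> by auto
      from branch_of_blown_up_zero[OF span u(2) this p] show ?thesis unfolding u(1) .
    qed
    from this[of 1] this[of "-1"]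
    show "\<exists>y y'. square_root_branch G p D (\<alpha> *\<^sub>R v) y \<and> square_root_branch G p D (- \<alpha> *\<^sub>R v) y'"
      by simp
  qed
qed

end


section \<open>Second-order expansions\<close>

lemma continuously_differentiable_imp_differentiable:
  "continuously_differentiable (Suc k) f \<Longrightarrow> f differentiable at x"
  by (simp add: differentiable_on_eq_differentiable_at)

lemma continuously_differentiable_const: "continuously_differentiable k (\<lambda>_. a)"
  by (induction k arbitrary: a) (auto simp: frechet_derivative_const)

lemma continuously_differentiable_add:
  "continuously_differentiable k f \<Longrightarrow> continuously_differentiable k g \<Longrightarrow>
    continuously_differentiable k (\<lambda>x. f x + g x)"
proof (induction k arbitrary: f g)
  case (Suc k)
  note differentiable = Suc.prems[THEN continuously_differentiable_imp_differentiable]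
  have "frechet_derivative (\<lambda>x. f x + g x) (at x) =
      (\<lambda>e. frechet_derivative f (at x) e + frechet_derivative g (at x) e)" for x
    by (rule frechet_derivative_at[symmetric])
      (intro has_derivative_add differentiable[unfolded frechet_derivative_works])
  then show ?case using Suc by (auto intro!: differentiable_on_add)
qed (auto intro: continuous_intros)

lemma continuously_differentiable_cmult:
  "continuously_differentiable k f \<Longrightarrow> continuously_differentiable k (\<lambda>x. a * f x)"
proof (induction k arbitrary: f)
  case (Suc k)
  note differentiable = Suc.prems[THEN continuously_differentiable_imp_differentiable]
  have "frechet_derivative (\<lambda>x. a * f x) (at x) = (\<lambda>e. a * frechet_derivative f (at x) e)" for x
    by (rule frechet_derivative_at[symmetric])
      (intro has_derivative_mult_right differentiable[unfolded frechet_derivative_works])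
  then show ?case using Suc by (auto intro!: differentiable_on_mult)
qed (auto intro: continuous_intros)

lemma continuously_differentiable_sum:
  "(\<And>i. i \<in> I \<Longrightarrow> continuously_differentiable k (f i)) \<Longrightarrow>
    continuously_differentiable k (\<lambda>x. \<Sum>i\<in>I. f i x)"
  by (induction I rule: infinite_finite_induct)
    (auto intro: continuously_differentiable_const continuously_differentiable_add)

lemma frechet_derivative_basis_expansion:
  fixes f :: "'a::euclidean_space \<Rightarrow> real"
  assumes "f differentiable at x"
  shows "frechet_derivative f (at x) e = (\<Sum>b\<in>Basis. (e \<bullet> b) * frechet_derivative f (at x) b)"
  using Linear_Algebra.linear_componentwise[OF linear_frechet_derivative[OF assms], of e 1] by simp

lemma has_derivative_compose_linear:
  assumes "f differentiable at (L x)" "linear (L :: 'a::euclidean_space \<Rightarrow> 'b::euclidean_space)"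
  shows "((\<lambda>x. f (L x)) has_derivative (\<lambda>e. frechet_derivative f (at (L x)) (L e))) (at x)"
  using has_derivative_compose[of L L x UNIV, OF linear_imp_has_derivative
      assms(1)[unfolded frechet_derivative_works]] assms(2)
  by (simp add: linear_conv_bounded_linear)

lemma continuously_differentiable_compose_linear:
  fixes f :: "'b::euclidean_space \<Rightarrow> real" and L :: "'a::euclidean_space \<Rightarrow> 'b"
  assumes L: "linear L"
  shows "continuously_differentiable k f \<Longrightarrow> continuously_differentiable k (\<lambda>x. f (L x))"
proof (induction k arbitrary: f)
  case 0
  then show ?case
    using L by (auto intro: continuous_on_compose2[where g = f and t = UNIV] linear_continuous_on
        simp: linear_conv_bounded_linear)
next
  case (Suc k)
  note differentiable = continuously_differentiable_imp_differentiable[OF Suc.prems]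
  note derivative = has_derivative_compose_linear[OF differentiable L]
  have "frechet_derivative (\<lambda>x. f (L x)) (at x) e =
      (\<Sum>b\<in>Basis. (L e \<bullet> b) * frechet_derivative f (at (L x)) b)" for x e
    using frechet_derivative_at[OF derivative] frechet_derivative_basis_expansion[OF differentiable]
    by metis
  moreover have "(\<lambda>x. f (L x)) differentiable_on UNIV"
    using derivative by (auto simp: differentiable_on_eq_differentiable_at differentiable_def)
  ultimately show ?case
    using Suc by (auto intro!: continuously_differentiable_sum continuously_differentiable_cmult)
qed

lemma continuously_differentiable_frechet_derivative:
  fixes f :: "'a::euclidean_space \<Rightarrow> real"
  assumes "continuously_differentiable (Suc k) f"
  shows "continuously_differentiable k (\<lambda>x. frechet_derivative f (at x) e)"
proof -
  have "(\<lambda>x. frechet_derivative f (at x) e) =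
      (\<lambda>x. \<Sum>b\<in>Basis. (e \<bullet> b) * frechet_derivative f (at x) b)"
    by (rule ext frechet_derivative_basis_expansion
        continuously_differentiable_imp_differentiable[OF assms])+
  then show ?thesis
    using assms by (auto intro!: continuously_differentiable_sum continuously_differentiable_cmult)
qed

lemma continuously_differentiable_imp_continuous_on:
  "continuously_differentiable k f \<Longrightarrow> continuous_on UNIV f"
  by (cases k) (auto intro: differentiable_imp_continuous_on)

lemma continuously_differentiable_2_imp_differentiable:
  assumes "continuously_differentiable 2 f"
  shows "f differentiable at x" and "(\<lambda>y. frechet_derivative f (at y) p) differentiable at x"
proof -
  have f: "continuously_differentiable (Suc (Suc 0)) f" using assms by (simp add: numeral_2_eq_2)
  show "f differentiable at x" "(\<lambda>y. frechet_derivative f (at y) p) differentiable at x"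
    by (rule continuously_differentiable_imp_differentiable[OF f]
        continuously_differentiable_imp_differentiable[OF
          continuously_differentiable_frechet_derivative[OF f]])+
qed

definition second_derivative ::
    "('a::euclidean_space \<Rightarrow> real) \<Rightarrow> 'a \<Rightarrow> 'a \<Rightarrow> 'a \<Rightarrow> real" where
  "second_derivative f x p q = frechet_derivative (\<lambda>y. frechet_derivative f (at y) p) (at x) q"

lemma second_derivative_basis_expansion:
  fixes f :: "'a::euclidean_space \<Rightarrow> real"
  assumes f: "continuously_differentiable 2 f"
  shows "second_derivative f x p q =
    (\<Sum>a\<in>Basis. \<Sum>b\<in>Basis. (p \<bullet> a) * (q \<bullet> b) * second_derivative f x a b)"
proof -
  note differentiable = continuously_differentiable_2_imp_differentiable[OF f]
  have "second_derivative f x p = (\<lambda>e. \<Sum>a\<in>Basis. (p \<bullet> a) * second_derivative f x a e)"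
    unfolding second_derivative_def
      frechet_derivative_basis_expansion[OF differentiable(1), of _ p]
    by (intro frechet_derivative_at[symmetric] has_derivative_sum has_derivative_mult_right
        differentiable(2)[unfolded frechet_derivative_works])
  moreover have "second_derivative f x a q =
      (\<Sum>b\<in>Basis. (q \<bullet> b) * second_derivative f x a b)" for a
    unfolding second_derivative_def
    by (rule frechet_derivative_basis_expansion[OF differentiable(2)])
  ultimately show ?thesis by (simp add: sum_distrib_left mult.assoc)
qed

lemma bilinear_second_derivative:
  assumes "continuously_differentiable 2 f"
  shows "bilinear (second_derivative f x)"
proof -
  have "linear (\<lambda>p. second_derivative f x p q)" for q
    unfolding second_derivative_basis_expansion[OF assms, of x _ q]
    by (rule linearI)
      (simp_all add: inner_add_left distrib_right sum.distrib sum_distrib_left mult.assoc)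
  moreover have "linear (\<lambda>q. second_derivative f x p q)" for p
    unfolding second_derivative_basis_expansion[OF assms, of x p]
    by (rule linearI)
      (simp_all add: inner_add_left distrib_left distrib_right sum.distrib sum_distrib_left mult_ac)
  ultimately show ?thesis by (simp add: bilinear_def)
qed

lemma continuous_on_second_derivative:
  fixes f :: "'a::euclidean_space \<Rightarrow> real"
  assumes f: "continuously_differentiable 2 f"
    and "continuous_on S g" "continuous_on S p" "continuous_on S q"
  shows "continuous_on S (\<lambda>x. second_derivative f (g x) (p x) (q x))"
proof -
  have f': "continuously_differentiable (Suc (Suc 0)) f" using f by (simp add: numeral_2_eq_2)
  have "continuous_on UNIV (\<lambda>x. second_derivative f x a b)" for a b
    unfolding second_derivative_def
    by (intro continuously_differentiable_imp_continuous_on[of 0]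
        continuously_differentiable_frechet_derivative f')
  then have "continuous_on S (\<lambda>x. second_derivative f (g x) a b)" for a b
    by (rule continuous_on_compose2) (use assms(2) in auto)
  then show ?thesis
    unfolding second_derivative_basis_expansion[OF f, of _ "p _" "q _"]
    by (intro continuous_intros assms)
qed

lemma second_derivative_compose_linear:
  fixes f :: "'b::euclidean_space \<Rightarrow> real" and L :: "'a::euclidean_space \<Rightarrow> 'b"
  assumes f: "continuously_differentiable 2 f" and L: "linear L"
  shows "second_derivative (\<lambda>x. f (L x)) x p q = second_derivative f (L x) (L p) (L q)"
proof -
  note differentiable = continuously_differentiable_2_imp_differentiable[OF f]
  have chain: "frechet_derivative (\<lambda>x. \<phi> (L x)) (at y) e = frechet_derivative \<phi> (at (L y)) (L e)"
    if "\<And>z. \<phi> differentiable at z" for \<phi> :: "'b \<Rightarrow> real" and y e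
    using frechet_derivative_at[OF has_derivative_compose_linear[OF that L]]
    by (rule fun_cong[symmetric])
  show ?thesis
    unfolding second_derivative_def chain[OF differentiable(1)]
    by (rule chain[OF differentiable(2)])
qed

definition taylor_remainder :: "('a::euclidean_space \<Rightarrow> real) \<Rightarrow> 'a \<Rightarrow> 'a \<Rightarrow> 'a \<Rightarrow> real" where
  "taylor_remainder f a x q = integral {0..1} (\<lambda>t. (1 - t) * second_derivative f (a + t *\<^sub>R x) q q)"

theorem taylor_second_order:
  fixes f :: "'a::euclidean_space \<Rightarrow> real"
  assumes f: "continuously_differentiable 2 f"
  shows "f (a + x) = f a + frechet_derivative f (at a) x + taylor_remainder f a x x"
proof -
  define D where "D i t = (if i = 0 then f (a + t *\<^sub>R x) else if i = 1
    then frechet_derivative f (at (a + t *\<^sub>R x)) x else second_derivative f (a + t *\<^sub>R x) x x)"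
    for i :: nat and t :: real
  have along_segment: "((\<lambda>t. \<phi> (a + t *\<^sub>R x)) has_vector_derivative
      frechet_derivative \<phi> (at (a + t *\<^sub>R x)) x) (at t within {0..1})"
    if "\<And>y. \<phi> differentiable at y" for \<phi> :: "'a \<Rightarrow> real" and t :: real
  proof -
    have "((\<lambda>t. a + t *\<^sub>R x) has_vector_derivative x) (at t within {0..1})"
      by (auto intro!: derivative_eq_intros)
    from vector_derivative_diff_chain_within[OF this has_derivative_at_withinI]
    show ?thesis using that by (auto simp: comp_def frechet_derivative_works)
  qed
  have "(D i has_vector_derivative D (Suc i) t) (at t within {0..1})" if "i < 2" for i t
    using that continuously_differentiable_2_imp_differentiable[OF f, THEN along_segment]
    by (auto simp: D_def[abs_def] second_derivative_def less_2_cases_iff)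
  then have "D 0 1 = (\<Sum>i<2. ((1 - 0) ^ i / fact i) *\<^sub>R D i 0) +
      integral {0..1} (\<lambda>t. ((1 - t) ^ (2 - 1) / fact (2 - 1)) *\<^sub>R D 2 t)"
    by (intro Taylor_integral) auto
  then show ?thesis by (simp add: D_def taylor_remainder_def numeral_2_eq_2)
qed

lemma taylor_remainder_scaleR:
  assumes "continuously_differentiable 2 f"
  shows "taylor_remainder f a x (r *\<^sub>R q) = r\<^sup>2 * taylor_remainder f a x q"
proof -
  have "second_derivative f y (r *\<^sub>R q) (r *\<^sub>R q) = r\<^sup>2 * second_derivative f y q q" for y
    using bilinear_second_derivative[OF assms, of y]
    by (simp add: bilinear_lmul bilinear_rmul power2_eq_square)
  then show ?thesis
    by (simp only: taylor_remainder_def mult.left_commute[of _ "r\<^sup>2"] integral_mult_right)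
qed

lemma taylor_remainder_0: "taylor_remainder f a 0 q = second_derivative f a q q / 2"
proof -
  have "((\<lambda>t :: real. 1 - t) has_integral (1 - 1\<^sup>2 / 2) - (0 - 0\<^sup>2 / 2)) {0..1}"
    by (rule fundamental_theorem_of_calculus[where f = "\<lambda>t. t - t\<^sup>2 / 2"])
      (auto intro!: derivative_eq_intros simp flip: has_real_derivative_iff_has_vector_derivative)
  then have "integral {0..1} (\<lambda>t :: real. 1 - t) = 1 / 2" by (simp add: integral_unique)
  then show ?thesis by (simp add: taylor_remainder_def)
qed

lemma continuous_on_taylor_remainder:
  assumes f: "continuously_differentiable 2 f" and "continuous_on S g" "continuous_on S q"
  shows "continuous_on S (\<lambda>x. taylor_remainder f a (g x) (q x))"
proof -
  have "continuous_on (S \<times> cbox 0 1) (\<lambda>y. g (fst y))"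
    "continuous_on (S \<times> cbox 0 1) (\<lambda>y. q (fst y))"
    by (auto intro!: continuous_on_compose2[OF assms(2)] continuous_on_compose2[OF assms(3)]
        continuous_intros)
  then have "continuous_on (S \<times> cbox 0 1)
      (\<lambda>(x, t :: real). (1 - t) * second_derivative f (a + t *\<^sub>R g x) (q x) (q x))"
    unfolding case_prod_unfold by (intro continuous_intros continuous_on_second_derivative[OF f])
  from integral_continuous_on_param[OF this] show ?thesis
    by (simp add: taylor_remainder_def)
qed


section \<open>Admissible systems and their Jacobians\<close>

abbreviation internal_derivative :: "(real \<times> real \<Rightarrow> real) \<Rightarrow> real" where
  "internal_derivative g \<equiv> deriv (\<lambda>x. g (x, 0)) 0"

abbreviation coupling_derivative :: "(real \<times> real \<times> real \<Rightarrow> real) \<Rightarrow> real" where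
  "coupling_derivative h \<equiv> deriv (\<lambda>x. h (x, 0, 0)) 0"

definition cell_function ::
    "(real \<times> real \<Rightarrow> real) \<Rightarrow> (real \<times> real \<times> real \<Rightarrow> real) \<Rightarrow> real^'n^'n \<Rightarrow> 'n \<Rightarrow>
     (real^'n) \<times> real \<Rightarrow> real" where
  "cell_function g h W i p = admissible g h W (fst p) (snd p) $ i"

lemma smooth_imp_differentiable: "smooth f \<Longrightarrow> f differentiable at x"
  unfolding smooth_def using continuously_differentiable_imp_differentiable by blast

lemma linear_cell_arguments:
  "linear (\<lambda>p::(real^'n) \<times> real. (fst p $ i, snd p))"
  "linear (\<lambda>p::(real^'n) \<times> real. (fst p $ i, fst p $ j, snd p))"
  by (auto intro!: linearI)

lemma cell_function_Pair [simp]: "cell_function g h W i (x, l) = admissible g h W x l $ i"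
  by (simp add: cell_function_def)

lemma continuously_differentiable_cell_function:
  assumes "smooth g" and "smooth h"
  shows "continuously_differentiable k (cell_function g h W i)"
proof -
  have "continuously_differentiable k g" "continuously_differentiable k h"
    using assms by (auto simp: smooth_def)
  then show ?thesis
    unfolding cell_function_def[abs_def] admissible_def vec_lambda_beta
    by (intro continuously_differentiable_add continuously_differentiable_sum
        continuously_differentiable_cmult
        continuously_differentiable_compose_linear[OF linear_cell_arguments(1), where f = g]
        continuously_differentiable_compose_linear[OF linear_cell_arguments(2), where f = h])
qed

lemma differentiable_cell_function:
  "smooth g \<Longrightarrow> smooth h \<Longrightarrow> cell_function g h W i differentiable at p"
  by (intro continuously_differentiable_imp_differentiable
      continuously_differentiable_cell_function)

lemma frechet_derivative_along_line:
  fixes f :: "'a::euclidean_space \<Rightarrow> real"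
  assumes "f differentiable at 0"
  shows "frechet_derivative f (at 0) e = deriv (\<lambda>t. f (t *\<^sub>R e)) 0"
proof -
  have "((\<lambda>t. f (t *\<^sub>R e)) has_derivative (\<lambda>t. frechet_derivative f (at 0) (t *\<^sub>R e))) (at 0)"
    using has_derivative_compose_linear[of f "\<lambda>t. t *\<^sub>R e" 0] assms
    by (simp add: linear_iff scaleR_add_left)
  then have "((\<lambda>t. f (t *\<^sub>R e)) has_real_derivative frechet_derivative f (at 0) e) (at 0)"
    by (simp add: has_field_derivative_def linear_scale[OF linear_frechet_derivative[OF assms]]
        mult_commute_abs)
  then show ?thesis by (rule DERIV_imp_deriv[symmetric])
qed

lemma frechet_derivative_cell_function:
  assumes g: "smooth g" and h: "smooth h"
  shows "frechet_derivative (cell_function g h W i) (at 0) (x, l) =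
    frechet_derivative g (at 0) (x $ i, l) +
    (\<Sum>j\<in>UNIV. W $ i $ j * frechet_derivative h (at 0) (x $ i, x $ j, l))"
proof -
  have "((\<lambda>p. g (fst p $ i, snd p)) has_derivative
      (\<lambda>e. frechet_derivative g (at 0) (fst e $ i, snd e))) (at 0)"
    using has_derivative_compose_linear[OF smooth_imp_differentiable[OF g]
        linear_cell_arguments(1), of i 0]
    by (simp add: zero_prod_def)
  moreover have "((\<lambda>p. h (fst p $ i, fst p $ j, snd p)) has_derivative
      (\<lambda>e. frechet_derivative h (at 0) (fst e $ i, fst e $ j, snd e))) (at 0)" for j
    using has_derivative_compose_linear[OF smooth_imp_differentiable[OF h]
        linear_cell_arguments(2), of i j 0]
    by (simp add: zero_prod_def)
  ultimately have "(cell_function g h W i has_derivative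
      (\<lambda>e. frechet_derivative g (at 0) (fst e $ i, snd e) +
        (\<Sum>j\<in>UNIV. W $ i $ j * frechet_derivative h (at 0) (fst e $ i, fst e $ j, snd e)))) (at 0)"
    unfolding cell_function_def[abs_def] admissible_def vec_lambda_beta
    by (intro has_derivative_add has_derivative_sum has_derivative_mult_right)
  from fun_cong[OF frechet_derivative_at[OF this], of "(x, l)"] show ?thesis by simp
qed

lemma jacobian_origin_mult:
  assumes g: "smooth g" and h: "smooth h"
  shows "(jacobian_origin (admissible g h W) *v x) $ i =
    frechet_derivative (cell_function g h W i) (at 0) (x, 0)"
proof -
  let ?D = "\<lambda>i. frechet_derivative (cell_function g h W i) (at 0)"
  have "((\<lambda>x. admissible g h W x 0 $ i) has_derivative (\<lambda>e. ?D i (e, 0))) (at 0)" for i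
    using has_derivative_compose_linear[OF differentiable_cell_function[OF g h],
        of "\<lambda>x. (x, 0)" W i 0]
    by (simp add: zero_prod_def linear_iff)
  then have "((\<lambda>x. admissible g h W x 0) has_derivative (\<lambda>e. \<chi> i. ?D i (e, 0))) (at 0)"
    unfolding has_derivative_componentwise_within[of "\<lambda>x. admissible g h W x 0"]
    by (auto simp: Basis_vec_def inner_axis)
  moreover from this have "((\<lambda>x. admissible g h W x 0) has_derivative
      (*v) (jacobian_origin (admissible g h W))) (at 0)"
    unfolding jacobian_origin_def jacobian_works[symmetric] differentiable_def by blast
  ultimately have "(*v) (jacobian_origin (admissible g h W)) = (\<lambda>e. \<chi> i. ?D i (e, 0))"
    by (rule has_derivative_unique[rotated])
  then show ?thesis by simp
qed

lemma laplacian_mult: "(laplacian W *v x) $ i = (\<Sum>j\<in>UNIV. W $ i $ j * (x $ i - x $ j))"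
proof -
  have "(laplacian W *v x) $ i =
      (\<Sum>j\<in>UNIV. (if i = j then input_valency W i * x $ i else 0) - W $ i $ j * x $ j)"
    unfolding matrix_vector_mult_def vec_lambda_beta
    by (rule sum.cong) (auto simp: laplacian_def left_diff_distrib)
  also have "\<dots> = (\<Sum>j\<in>UNIV. W $ i $ j * (x $ i - x $ j))"
    by (simp add: input_valency_def sum_subtractf sum_distrib_right right_diff_distrib)
  finally show ?thesis .
qed

theorem jacobian_origin_admissible:
  assumes g: "smooth g" and h: "smooth h" and "diffusive h"
  shows "jacobian_origin (admissible g h W) =
    internal_derivative g *\<^sub>R mat 1 + coupling_derivative h *\<^sub>R laplacian W"
proof -
  let ?Dg = "frechet_derivative g (at 0)" and ?Dh = "frechet_derivative h (at 0)"
  note differentiable_g = smooth_imp_differentiable[OF g, of 0]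
    and differentiable_h = smooth_imp_differentiable[OF h, of 0]
  note linear_Dg = linear_frechet_derivative[OF differentiable_g]
    and linear_Dh = linear_frechet_derivative[OF differentiable_h]
  have Dg: "?Dg (a, 0) = internal_derivative g * a" for a
    using linear_scale[OF linear_Dg, of a "(1, 0)"]
      frechet_derivative_along_line[OF differentiable_g, of "(1, 0)"]
    by simp
  have Dh: "?Dh (a, b, 0) = coupling_derivative h * (a - b)" for a b
  proof -
    have "?Dh (1, 1, 0) = 0" "?Dh (1, 0, 0) = coupling_derivative h"
      using \<open>diffusive h\<close>
      by (simp_all add: frechet_derivative_along_line[OF differentiable_h] diffusive_def)
    moreover have "(a, b, 0 :: real) = (a - b) *\<^sub>R (1, 0, 0) + b *\<^sub>R (1, 1, 0)" by simp
    ultimately show ?thesis by (simp only: linear_add[OF linear_Dh] linear_scale[OF linear_Dh]) simp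
  qed
  have "jacobian_origin (admissible g h W) *v x =
      (internal_derivative g *\<^sub>R mat 1 + coupling_derivative h *\<^sub>R laplacian W) *v x" for x
    by (simp add: vec_eq_iff jacobian_origin_mult[OF g h] frechet_derivative_cell_function[OF g h]
        Dg Dh matrix_vector_mult_add_rdistrib laplacian_mult sum_distrib_left mult.left_commute
        flip: scaleR_matrix_vector_assoc)
  then show ?thesis by (simp add: matrix_eq)
qed

lemma inner_hessian:
  fixes f :: "real^'n \<Rightarrow> real"
  assumes f: "continuously_differentiable 2 f"
  shows "p \<bullet> (hessian f x *v q) = second_derivative f x q p"
proof -
  have Basis: "(\<Sum>b\<in>Basis. \<phi> b) = (\<Sum>i\<in>UNIV. \<phi> (axis i 1))" for \<phi> :: "real^'n \<Rightarrow> real"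
  proof -
    have Basis_range: "(Basis :: (real^'n) set) = range (\<lambda>i. axis i 1)"
      by (auto simp: Basis_vec_def)
    show ?thesis unfolding Basis_range by (simp add: sum.reindex inj_on_def axis_eq_axis)
  qed
  have "p \<bullet> (hessian f x *v q) =
      (\<Sum>i\<in>UNIV. \<Sum>j\<in>UNIV. q $ j * p $ i * second_derivative f x (axis j 1) (axis i 1))"
    by (simp add: inner_vec_def matrix_vector_mult_def hessian_def second_derivative_def
        sum_distrib_left mult_ac)
  also have "\<dots> = second_derivative f x q p"
    unfolding second_derivative_basis_expansion[OF f, of x q p] Basis
    by (subst sum.swap) (simp add: inner_axis)
  finally show ?thesis .
qed


section \<open>The cells driven by the coalescence cell\<close>

lemma sum_UNIV_option:
  fixes f :: "'q::finite option \<Rightarrow> 'b::comm_monoid_add"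
  shows "(\<Sum>i\<in>UNIV. f i) = f None + (\<Sum>d\<in>UNIV. f (Some d))"
  by (simp add: UNIV_option_conv sum.reindex)

lemma sum_UNIV_sum_type:
  fixes f :: "'p::finite + 'q::finite \<Rightarrow> 'b::comm_monoid_add"
  shows "(\<Sum>a\<in>UNIV. f a) = (\<Sum>i\<in>UNIV. f (Inl i)) + (\<Sum>d\<in>UNIV. f (Inr d))"
  by (simp add: UNIV_Plus_UNIV[symmetric] sum.Plus del: UNIV_Plus_UNIV)

definition extend :: "real^'q::finite \<Rightarrow> real \<Rightarrow> real^('q option)" where
  "extend y s = (\<chi> i. case i of None \<Rightarrow> s | Some d \<Rightarrow> y $ d)"

lemma extend_nth [simp]: "extend y s $ None = s" "extend y s $ Some d = y $ d"
  by (simp_all add: extend_def)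

lemma matrix_mult_extend:
  "(A *v extend y s) $ Some d = (without_c A *v y + s *\<^sub>R c_column A) $ d"
  by (simp add: matrix_vector_mult_def sum_UNIV_option without_c_def c_column_def)

lemma inner_without_c: "y \<bullet> (without_c A *v z) = extend y 0 \<bullet> (A *v extend z 0)"
  by (simp add: inner_vec_def[of "extend y 0"] sum_UNIV_option matrix_mult_extend)
    (simp add: inner_vec_def)

definition driven_point :: "(real^'q::finite) \<times> real \<times> real \<Rightarrow> (real^('q option)) \<times> real" where
  "driven_point = (\<lambda>(y, s, l). (extend y s, l))"

definition driven ::
    "(real \<times> real \<Rightarrow> real) \<Rightarrow> (real \<times> real \<times> real \<Rightarrow> real) \<Rightarrow>
     real^('q::finite option)^('q option) \<Rightarrow> (real^'q) \<times> real \<times> real \<Rightarrow> real^'q" where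
  "driven g h W p = (\<chi> d. cell_function g h W (Some d) (driven_point p))"

definition driven_remainder ::
    "(real \<times> real \<Rightarrow> real) \<Rightarrow> (real \<times> real \<times> real \<Rightarrow> real) \<Rightarrow>
     real^('q::finite option)^('q option) \<Rightarrow> (real^'q) \<times> real \<times> real \<Rightarrow>
     (real^'q) \<times> real \<times> real \<Rightarrow> real^'q" where
  "driven_remainder g h W p q =
     (\<chi> d. taylor_remainder (cell_function g h W (Some d)) 0 (driven_point p) (driven_point q))"

lemma linear_driven_point: "linear driven_point"
  by (rule linearI) (auto simp: driven_point_def vec_eq_iff extend_def split: option.split)

lemma continuous_on_driven_point:
  "continuous_on S f \<Longrightarrow> continuous_on S (\<lambda>x. driven_point (f x))"
  by (rule continuous_on_compose2[OF linear_continuous_on[of _ UNIV]])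
    (use linear_driven_point in \<open>auto simp: linear_conv_bounded_linear\<close>)

lemma driven_linear_part:
  assumes g: "smooth g" and h: "smooth h" and equilibrium: "\<And>l. driven g h W (0, 0, l) = 0"
  shows "frechet_derivative (cell_function g h W (Some d)) (at 0) (driven_point (y, s, l)) =
    (without_c (jacobian_origin (admissible g h W)) *v y +
     s *\<^sub>R c_column (jacobian_origin (admissible g h W))) $ d"
proof -
  let ?f = "cell_function g h W (Some d)"
  note differentiable = differentiable_cell_function[OF g h]
  have "?f (t *\<^sub>R (0, 1)) = driven g h W (0, 0, t) $ d" for t
  proof -
    have "extend 0 0 = (0 :: real^('a option))"
      by (simp add: vec_eq_iff extend_def split: option.split)
    then show ?thesis by (simp add: driven_def driven_point_def)
  qed
  then have "frechet_derivative ?f (at 0) (0, 1) = 0"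
    by (simp add: frechet_derivative_along_line[OF differentiable] equilibrium del: scaleR_Pair)
  moreover have "driven_point (y, s, l) = (extend y s, 0) + l *\<^sub>R (0, 1)"
    by (simp add: driven_point_def)
  ultimately show ?thesis
    by (simp only: linear_add[OF linear_frechet_derivative[OF differentiable]]
        linear_scale[OF linear_frechet_derivative[OF differentiable]])
      (simp add: matrix_mult_extend flip: jacobian_origin_mult[OF g h])
qed

lemma driven_remainder_0:
  assumes g: "smooth g" and h: "smooth h"
  shows "driven_remainder g h W 0 (v, 0) = (1 / 2) *\<^sub>R hessian_vector (admissible g h W) v"
proof -
  have "v \<bullet> (without_c (hessian (\<lambda>x. cell_function g h W i (x, 0)) 0) *v v) =
      second_derivative (cell_function g h W i) 0 (extend v 0, 0) (extend v 0, 0)" for i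
  proof -
    have f: "continuously_differentiable 2 (cell_function g h W i)"
      by (rule continuously_differentiable_cell_function[OF g h])
    have slice: "linear (\<lambda>x :: real^('a option). (x, 0 :: real))" by (simp add: linear_iff)
    show ?thesis
      unfolding inner_without_c
        inner_hessian[OF continuously_differentiable_compose_linear[OF slice f]]
        second_derivative_compose_linear[OF f slice] by (simp add: zero_prod_def)
  qed
  moreover have "driven_point (v, 0) = (extend v 0, 0)"
    by (simp add: driven_point_def zero_prod_def)
  ultimately show ?thesis
    by (simp add: vec_eq_iff driven_remainder_def hessian_vector_def taylor_remainder_0
        linear_0[OF linear_driven_point])
qed

lemma driven_quadratic_expansion:
  fixes g :: "real \<times> real \<Rightarrow> real" and h :: "real \<times> real \<times> real \<Rightarrow> real"
    and W :: "real^('q::finite option)^('q option)"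
  defines "J \<equiv> jacobian_origin (admissible g h W)"
  assumes g: "smooth g" and h: "smooth h" and equilibrium: "\<And>l. driven g h W (0, 0, l) = 0"
    and v: "without_c J *v v = 0" "v \<noteq> 0"
  shows "quadratic_expansion (driven g h W) (\<lambda>(y, s, l). without_c J *v y + s *\<^sub>R c_column J)
    (driven_remainder g h W) v"
proof (rule quadratic_expansion.intro)
  have f: "continuously_differentiable 2 (cell_function g h W i)" for i
    by (rule continuously_differentiable_cell_function[OF g h])
  show "linear (\<lambda>(y, s :: real, l :: real). without_c J *v y + s *\<^sub>R c_column J)"
    by (rule linearI)
      (auto simp: matrix_vector_right_distrib matrix_vector_mult_scaleR algebra_simps)
  show "continuous_on UNIV (\<lambda>(p, q). driven_remainder g h W p q)"
    unfolding driven_remainder_def case_prod_unfold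
    by (intro continuous_on_vec_lambda continuous_on_taylor_remainder[OF f]
        continuous_on_driven_point continuous_intros)
  show "driven_remainder g h W p (r *\<^sub>R q) = r\<^sup>2 *\<^sub>R driven_remainder g h W p q" for p r q
    by (simp add: vec_eq_iff driven_remainder_def linear_scale[OF linear_driven_point]
        taylor_remainder_scaleR[OF f])
  have "driven g h W 0 = 0" using equilibrium[of 0] by (simp add: zero_prod_def)
  then have "cell_function g h W (Some d) 0 = 0" for d
    by (simp add: driven_def vec_eq_iff linear_0[OF linear_driven_point])
  then show "driven g h W p =
      (case p of (y, s, l) \<Rightarrow> without_c J *v y + s *\<^sub>R c_column J) + driven_remainder g h W p p" for p
    using taylor_second_order[OF f, of _ 0 "driven_point p"]
      driven_linear_part[OF g h equilibrium, of _ "fst p" "fst (snd p)" "snd (snd p)"]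
    by (simp add: vec_eq_iff driven_def driven_remainder_def J_def case_prod_unfold)
qed (use v in \<open>simp_all add: case_prod_unfold\<close>)

lemma driven_fold_branches:
  fixes g :: "real \<times> real \<Rightarrow> real" and h :: "real \<times> real \<times> real \<Rightarrow> real"
    and W :: "real^('q::finite option)^('q option)"
  defines "J \<equiv> jacobian_origin (admissible g h W)"
  assumes g: "smooth g" and h: "smooth h" and equilibrium: "\<And>l. driven g h W (0, 0, l) = 0"
    and rank: "rank (without_c J) = CARD('q) - 1" and v: "without_c J *v v = 0" "v \<noteq> 0"
    and column: "\<beta> *\<^sub>R c_column J \<notin> range ((*v) (without_c J))"
    and hessian: "hessian_vector (admissible g h W) v \<notin> range ((*v) (without_c J))"
  obtains \<sigma> \<alpha> :: real where "\<sigma> \<in> {1, -1}" "\<alpha> > 0"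
    "\<And>D s. D \<subseteq> {l. 0 \<le> \<sigma> * l} \<Longrightarrow> s 0 = 0 \<Longrightarrow> (s has_real_derivative \<beta>) (at 0 within D) \<Longrightarrow>
      \<exists>y y'. square_root_branch (driven g h W) (\<lambda>l. (s l, l)) D (\<alpha> *\<^sub>R v) y \<and>
        square_root_branch (driven g h W) (\<lambda>l. (s l, l)) D (- \<alpha> *\<^sub>R v) y'"
proof -
  let ?A = "\<lambda>(y, s :: real, l :: real). without_c J *v y + s *\<^sub>R c_column J"
  interpret quadratic_expansion "driven g h W" ?A "driven_remainder g h W" v
    unfolding J_def by (rule driven_quadratic_expansion) (use assms in auto)
  have "span (insert ((1 / 2) *\<^sub>R hessian_vector (admissible g h W) v)
      (range ((*v) (without_c J)))) = UNIV"
    using hessian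
    by (intro span_insert_range_corank_one[OF rank]) (simp add: scaleR_mem_range_iff)
  then have span: "span (insert (driven_remainder g h W 0 (v, 0)) (range (\<lambda>u. ?A (u, 0)))) = UNIV"
    by (simp add: driven_remainder_0[OF g h] case_prod_unfold)
  have transversal: "?A (0, \<beta>, 1) \<notin> range (\<lambda>u. ?A (u, 0))"
    using column by (simp add: zero_prod_def)
  obtain \<sigma> \<alpha> :: real where "\<sigma> \<in> {1, -1}" "\<alpha> > 0"
    and branches: "\<And>D p. D \<subseteq> {l. 0 \<le> \<sigma> * l} \<Longrightarrow> p 0 = 0 \<Longrightarrow>
      (p has_vector_derivative (\<beta>, 1)) (at 0 within D) \<Longrightarrow>
      \<exists>y y'. square_root_branch (driven g h W) p D (\<alpha> *\<^sub>R v) y \<and>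
        square_root_branch (driven g h W) p D (- \<alpha> *\<^sub>R v) y'"
    by (rule fold_branches[OF span transversal]) blast
  moreover have "((\<lambda>l. (s l, l)) has_vector_derivative (\<beta>, 1)) (at 0 within D)"
    if "(s has_real_derivative \<beta>) (at 0 within D)" for s D
    using that by (intro has_vector_derivative_Pair has_vector_derivative_id)
      (simp add: has_real_derivative_iff_has_vector_derivative)
  ultimately show thesis by (intro that[of \<sigma> \<alpha>] branches) (auto simp: zero_prod_def)
qed


section \<open>Spectral consequences of the bifurcation condition\<close>

lemma eigenvalue_laplacian_zero: "eigenvalue (laplacian W) 0"
proof -
  let ?x = "(\<chi> i. 1) :: complex^'a"
  have "map_matrix complex_of_real (laplacian W) *v ?x = 0 *s ?x"
    by (simp add: vec_eq_iff matrix_vector_mult_def laplacian_def input_valency_def sum_subtractf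
        flip: of_real_sum)
  moreover have "?x \<noteq> 0" by (simp add: vec_eq_iff)
  ultimately show ?thesis unfolding eigenvalue_def by blast
qed

lemma eigenvalue_coalescence_single_driven_cell:
  fixes W2 :: "real^('q::finite option)^('q option)"
  assumes "feedforward W2" and single: "(UNIV :: 'q set) = {d}"
  shows "eigenvalue (laplacian (coalescence c W1 W2)) (complex_of_real (W2 $ Some d $ None))"
proof -
  let ?A = "map_matrix complex_of_real (laplacian (coalescence c W1 W2))"
  let ?x = "axis (Inr d) 1 :: complex^('a + 'q)"
  have column: "(?A *v ?x) $ a = ?A $ a $ Inr d" for a
    by (simp add: matrix_vector_mult_def axis_def if_distrib[of "\<lambda>z. _ * z"] cong: if_cong)
  have "(?A *v ?x) $ a = (complex_of_real (W2 $ Some d $ None) *s ?x) $ a" for a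
  proof (cases a)
    case (Inl i)
    then show ?thesis
      unfolding column using assms(1)
      by (simp add: map_matrix_def laplacian_def coalescence_def axis_def feedforward_def)
  next
    case (Inr e)
    moreover have "e = d" using single by auto
    ultimately show ?thesis
      unfolding column
      by (simp add: map_matrix_def laplacian_def coalescence_def axis_def
          input_valency_def sum_UNIV_sum_type single)
  qed
  then have "?A *v ?x = complex_of_real (W2 $ Some d $ None) *s ?x" by (simp add: vec_eq_iff)
  moreover have "?x \<noteq> 0" by simp
  ultimately show ?thesis unfolding eigenvalue_def by blast
qed

lemma c_column_jacobian_origin:
  assumes "smooth g" and "smooth h" and "diffusive h"
  shows "c_column (jacobian_origin (admissible g h W)) =
    coupling_derivative h *\<^sub>R c_column (laplacian W)"
  by (simp add: vec_eq_iff c_column_def jacobian_origin_admissible[OF assms] mat_def)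

lemma coupling_derivative_nonzero:
  fixes W2 :: "real^('q::finite option)^('q option)"
  assumes feedforward: "feedforward W2"
    and admissible: "smooth g" "smooth h" "diffusive h"
    and unique: "\<exists>!\<mu>. eigenvalue (laplacian (coalescence c W1 W2)) \<mu> \<and> bifurcation_condition g h \<mu>"
    and rank: "rank (without_c (jacobian_origin (admissible g h W2))) = CARD('q) - 1"
    and column: "c_column (laplacian W2) \<noteq> 0"
  shows "coupling_derivative h \<noteq> 0"
proof
  assume coupling_zero: "coupling_derivative h = 0"
  then have "bifurcation_condition g h \<mu> \<longleftrightarrow> internal_derivative g = 0" for \<mu>
    by (simp add: bifurcation_condition_def)
  with unique have internal_zero: "internal_derivative g = 0"
    and unique_eigenvalue: "\<exists>!\<mu>. eigenvalue (laplacian (coalescence c W1 W2)) \<mu>"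
    by auto
  have "without_c (jacobian_origin (admissible g h W2)) = 0"
    by (simp add: without_c_def vec_eq_iff jacobian_origin_admissible[OF admissible]
        internal_zero coupling_zero)
  then have "CARD('q) = 1" using rank zero_less_card_finite[where 'a = 'q] by (simp add: le_Suc_eq)
  then obtain d where d: "(UNIV :: 'q set) = {d}" using card_1_singletonE by blast
  have "complex_of_real (W2 $ Some d $ None) = 0"
    using unique_eigenvalue eigenvalue_laplacian_zero
      eigenvalue_coalescence_single_driven_cell[OF feedforward d] by blast
  then have "c_column (laplacian W2) $ e = 0" for e
    using d by (auto simp: c_column_def laplacian_def)
  with column show False by (simp add: vec_eq_iff)
qed

lemma forcing_not_in_range:
  fixes g :: "real \<times> real \<Rightarrow> real" and h :: "real \<times> real \<times> real \<Rightarrow> real"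
    and W2 :: "real^('q::finite option)^('q option)"
  defines "J \<equiv> jacobian_origin (admissible g h W2)"
  assumes "feedforward W2" and admissible: "smooth g" "smooth h" "diffusive h"
    and "\<exists>!\<mu>. eigenvalue (laplacian (coalescence c W1 W2)) \<mu> \<and> bifurcation_condition g h \<mu>"
    and "rank (without_c J) = CARD('q) - 1"
    and column: "\<beta> *\<^sub>R c_column (laplacian W2) \<notin> range ((*v) (without_c J))"
  shows "\<beta> *\<^sub>R c_column J \<notin> range ((*v) (without_c J))"
proof -
  have "0 \<in> range ((*v) (without_c J))" by (rule range_eqI[of _ _ 0]) simp
  with column have "c_column (laplacian W2) \<noteq> 0" by auto
  then have "coupling_derivative h \<noteq> 0"
    using assms(2-7) unfolding J_def by (intro coupling_derivative_nonzero)
  moreover have "\<beta> *\<^sub>R c_column J = coupling_derivative h *\<^sub>R \<beta> *\<^sub>R c_column (laplacian W2)"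
    by (simp add: J_def c_column_jacobian_origin[OF admissible])
  ultimately show ?thesis using column by (metis matrix_vector_mul_linear scaleR_mem_range_iff)
qed


section \<open>Branches of the coalescence\<close>

lemma join_nth [simp]: "join x y $ Inl i = x $ i" "join x y $ Inr d = y $ d"
  by (simp_all add: join_def)

lemma join_eq_0_iff: "join x y = 0 \<longleftrightarrow> x = 0 \<and> y = 0"
  by (simp add: vec_eq_iff split_sum_all)

lemma join_0 [simp]: "join 0 0 = 0"
  by (simp add: join_eq_0_iff)

lemma admissible_coalescence:
  assumes "feedforward W2" and "diffusive h"
  shows "admissible g h (coalescence c W1 W2) (join x y) l =
    join (admissible g h W1 x l) (driven g h W2 (y, x $ c, l))"
proof -
  have "admissible g h (coalescence c W1 W2) (join x y) l $ a =
    join (admissible g h W1 x l) (driven g h W2 (y, x $ c, l)) $ a" for a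
  proof (cases a)
    case (Inl i)
    have diagonal: "(W1 $ i $ j + (if i = c \<and> j = c then W2 $ None $ None else 0)) *
        h (x $ i, x $ j, l) = W1 $ i $ j * h (x $ i, x $ j, l)" for j
      using assms(2) by (auto simp: diffusive_def)
    then show ?thesis
      using assms(1)
      by (simp add: Inl admissible_def coalescence_def sum_UNIV_sum_type
          feedforward_def diagonal cong: if_cong)
  next
    case (Inr d)
    then show ?thesis
      by (simp add: admissible_def coalescence_def driven_def driven_point_def sum_UNIV_sum_type
          sum_UNIV_option if_distrib[of "\<lambda>z. z * _"] cong: if_cong)
  qed
  then show ?thesis by (simp add: vec_eq_iff)
qed

lemma driven_equilibrium:
  assumes "feedforward W2" and "diffusive h" and "admissible g h (coalescence c W1 W2) 0 l = 0"
  shows "driven g h W2 (0, 0, l) = 0"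
  using admissible_coalescence[OF assms(1,2), of g c W1 0 0 l] assms(3) by (simp add: join_eq_0_iff)

lemma bifurcation_branch_join:
  assumes "feedforward W2" and "diffusive h" and equilibrium: "driven g h W2 (0, 0, 0) = 0"
    and b: "bifurcation_branch (admissible g h W1) D\<^sub>1 b"
    and D: "branch_domain D" "D \<subseteq> D\<^sub>1" "\<exists>l\<in>D. l \<noteq> 0" and "y 0 = 0"
    and y: "\<And>l. l \<in> D \<Longrightarrow> l \<noteq> 0 \<Longrightarrow> driven g h W2 (y l, b l $ c, l) = 0 \<and> y l \<noteq> 0"
  shows "bifurcation_branch (admissible g h (coalescence c W1 W2)) D (\<lambda>l. join (b l) (y l))"
proof -
  have b: "b 0 = 0" "\<And>l. l \<in> D \<Longrightarrow> admissible g h W1 (b l) l = 0"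
    using b D(2) by (auto simp: bifurcation_branch_def equilibrium_branch_def)
  have "driven g h W2 (y l, b l $ c, l) = 0" if "l \<in> D" for l
    using y[OF that] \<open>y 0 = 0\<close> equilibrium b(1) by (cases "l = 0") auto
  then show ?thesis
    using D(1,3) \<open>y 0 = 0\<close> b y
    by (auto simp: bifurcation_branch_def equilibrium_branch_def join_eq_0_iff
        admissible_coalescence[OF assms(1,2)])
qed

definition half_branch_domain :: "real \<Rightarrow> real \<Rightarrow> real set" where
  "half_branch_domain \<sigma> \<epsilon> = {l. 0 \<le> \<sigma> * l \<and> \<bar>l\<bar> < \<epsilon>}"

lemma branch_domain_half_branch_domain:
  assumes "\<sigma> \<in> {1, -1}" and "\<epsilon> > 0"
  shows "branch_domain (half_branch_domain \<sigma> \<epsilon>)"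
proof -
  have "half_branch_domain 1 \<epsilon> = {0..<\<epsilon>}" "half_branch_domain (-1) \<epsilon> = {-\<epsilon><..0}"
    by (auto simp: half_branch_domain_def)
  then show ?thesis using assms by (auto simp: branch_domain_def)
qed

lemma branch_domain_Int_half_branch_domain:
  assumes D: "branch_domain D" and \<sigma>: "\<sigma> \<in> {1, -1 :: real}"
    and side: "D \<inter> {l. 0 \<le> \<sigma> * l} \<noteq> {0}" and "\<epsilon> > 0"
  obtains \<delta> where "\<delta> > 0" "D \<inter> half_branch_domain \<sigma> \<epsilon> = half_branch_domain \<sigma> \<delta>"
proof -
  obtain e where e: "e > 0" "D = {-e<..<e} \<or> D = {0..<e} \<or> D = {-e<..0}"
    using D by (auto simp: branch_domain_def)
  then have "D = {-e<..<e} \<or> \<sigma> = 1 \<and> D = {0..<e} \<or> \<sigma> = -1 \<and> D = {-e<..0}"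
    using \<sigma> side by (elim disjE insertE) auto
  then have "D \<inter> half_branch_domain \<sigma> \<epsilon> = half_branch_domain \<sigma> (min e \<epsilon>)"
    by (auto simp: half_branch_domain_def)
  with e(1) \<open>\<epsilon> > 0\<close> show thesis by (intro that[of "min e \<epsilon>"]) auto
qed

lemma eventually_on_half_branch_domain:
  assumes D: "branch_domain D" and \<sigma>: "\<sigma> \<in> {1, -1 :: real}"
    and side: "D \<inter> {l. 0 \<le> \<sigma> * l} \<noteq> {0}"
    and near_0: "\<forall>\<^sub>F l in at 0 within D \<inter> {l. 0 \<le> \<sigma> * l}. P l"
  obtains D' where "branch_domain D'" "branch_domain (D \<inter> D')" "D' \<subseteq> {l. 0 \<le> \<sigma> * l}"
    "\<And>l. l \<in> D \<inter> D' \<Longrightarrow> l \<noteq> 0 \<Longrightarrow> P l" "\<exists>l\<in>D \<inter> D'. l \<noteq> 0"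
proof -
  obtain \<epsilon> where \<epsilon>: "\<epsilon> > 0" "\<And>l. l \<in> D \<Longrightarrow> 0 \<le> \<sigma> * l \<Longrightarrow> l \<noteq> 0 \<Longrightarrow> \<bar>l\<bar> < \<epsilon> \<Longrightarrow> P l"
    using near_0 by (auto simp: eventually_at)
  obtain \<delta> where \<delta>: "\<delta> > 0" "D \<inter> half_branch_domain \<sigma> \<epsilon> = half_branch_domain \<sigma> \<delta>"
    by (rule branch_domain_Int_half_branch_domain[OF D \<sigma> side \<epsilon>(1)])
  show thesis
  proof
    show "branch_domain (half_branch_domain \<sigma> \<epsilon>)" "branch_domain (D \<inter> half_branch_domain \<sigma> \<epsilon>)"
      unfolding \<delta>(2) using \<sigma> \<epsilon>(1) \<delta>(1) by (auto intro: branch_domain_half_branch_domain)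
    show "half_branch_domain \<sigma> \<epsilon> \<subseteq> {l. 0 \<le> \<sigma> * l}"
      "\<And>l. l \<in> D \<inter> half_branch_domain \<sigma> \<epsilon> \<Longrightarrow> l \<noteq> 0 \<Longrightarrow> P l"
      using \<epsilon>(2) by (auto simp: half_branch_domain_def)
    have "\<sigma> * \<delta> / 2 \<in> half_branch_domain \<sigma> \<delta>"
      using \<sigma> \<delta>(1) by (auto simp: half_branch_domain_def)
    then show "\<exists>l\<in>D \<inter> half_branch_domain \<sigma> \<epsilon>. l \<noteq> 0"
      unfolding \<delta>(2) by (rule bexI[rotated]) (use \<sigma> \<delta>(1) in auto)
  qed
qed

lemma coalescence_branch_pair:
  fixes W2 :: "real^('q::finite option)^('q option)" and v :: "real^'q"
  assumes "feedforward W2" and "diffusive h" and equilibrium: "driven g h W2 (0, 0, 0) = 0"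
    and b: "bifurcation_branch (admissible g h W1) D\<^sub>1 b" and \<sigma>: "\<sigma> \<in> {1, -1 :: real}"
    and side: "D\<^sub>1 \<inter> {l. 0 \<le> \<sigma> * l} \<noteq> {0}"
    and y: "square_root_branch (driven g h W2) (\<lambda>l. (b l $ c, l))
      (D\<^sub>1 \<inter> {l. 0 \<le> \<sigma> * l}) (\<alpha> *\<^sub>R v) y"
    and y': "square_root_branch (driven g h W2) (\<lambda>l. (b l $ c, l))
      (D\<^sub>1 \<inter> {l. 0 \<le> \<sigma> * l}) (- \<alpha> *\<^sub>R v) y'"
    and "\<alpha> \<noteq> 0" "v \<noteq> 0"
  shows "\<exists>D\<^sub>2. branch_domain D\<^sub>2 \<and>
    bifurcation_branch (admissible g h (coalescence c W1 W2)) (D\<^sub>1 \<inter> D\<^sub>2) (\<lambda>l. join (b l) (y l)) \<and>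
    bifurcation_branch (admissible g h (coalescence c W1 W2)) (D\<^sub>1 \<inter> D\<^sub>2) (\<lambda>l. join (b l) (y' l)) \<and>
    (\<exists>l\<in>D\<^sub>1 \<inter> D\<^sub>2. y l \<noteq> y' l) \<and>
    (\<forall>d. v $ d \<noteq> 0 \<longrightarrow>
      (\<lambda>l. join (b l) (y l) $ Inr d) \<in> \<Theta>[at 0 within (D\<^sub>1 \<inter> D\<^sub>2)](\<lambda>l. sqrt \<bar>l\<bar>) \<and>
      (\<lambda>l. join (b l) (y' l) $ Inr d) \<in> \<Theta>[at 0 within (D\<^sub>1 \<inter> D\<^sub>2)](\<lambda>l. sqrt \<bar>l\<bar>))"
proof -
  let ?F = "at 0 within D\<^sub>1 \<inter> {l. 0 \<le> \<sigma> * l}" and ?G = "driven g h W2"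
  have D1: "branch_domain D\<^sub>1"
    using b by (auto simp: bifurcation_branch_def equilibrium_branch_def)
  have limit: "((\<lambda>l. y l /\<^sub>R sqrt \<bar>l\<bar>) \<longlongrightarrow> \<alpha> *\<^sub>R v) ?F" "((\<lambda>l. y' l /\<^sub>R sqrt \<bar>l\<bar>) \<longlongrightarrow> - \<alpha> *\<^sub>R v) ?F"
    and zero: "y 0 = 0" "y' 0 = 0"
    and solves: "\<forall>\<^sub>F l in ?F. ?G (y l, b l $ c, l) = 0" "\<forall>\<^sub>F l in ?F. ?G (y' l, b l $ c, l) = 0"
    using y y' by (auto simp: square_root_branch_def)
  have distinct: "\<alpha> *\<^sub>R v \<noteq> 0" "- \<alpha> *\<^sub>R v \<noteq> 0" "\<alpha> *\<^sub>R v \<noteq> - \<alpha> *\<^sub>R v"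
    using \<open>\<alpha> \<noteq> 0\<close> \<open>v \<noteq> 0\<close> by (simp_all only: scaleR_eq_0_iff scaleR_cancel_right) simp_all
  have limit_0: "((\<lambda>l. (0 :: real^'q) /\<^sub>R sqrt \<bar>l\<bar>) \<longlongrightarrow> 0) ?F" by simp
  note separate = eventually_neq_of_scaled_limits
  from solves separate[OF limit(1) limit_0 distinct(1)] separate[OF limit(2) limit_0 distinct(2)]
    separate[OF limit distinct(3)]
  have "\<forall>\<^sub>F l in ?F. ?G (y l, b l $ c, l) = 0 \<and> ?G (y' l, b l $ c, l) = 0 \<and>
      y l \<noteq> 0 \<and> y' l \<noteq> 0 \<and> y l \<noteq> y' l"
    by eventually_elim blast
  then obtain D\<^sub>2 where D2: "branch_domain D\<^sub>2" "branch_domain (D\<^sub>1 \<inter> D\<^sub>2)" "D\<^sub>2 \<subseteq> {l. 0 \<le> \<sigma> * l}"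
    and on_D2: "\<And>l. l \<in> D\<^sub>1 \<inter> D\<^sub>2 \<Longrightarrow> l \<noteq> 0 \<Longrightarrow> ?G (y l, b l $ c, l) = 0 \<and> ?G (y' l, b l $ c, l) = 0 \<and>
      y l \<noteq> 0 \<and> y' l \<noteq> 0 \<and> y l \<noteq> y' l"
    and nonzero: "\<exists>l\<in>D\<^sub>1 \<inter> D\<^sub>2. l \<noteq> 0"
    by (rule eventually_on_half_branch_domain[OF D1 \<sigma> side]) blast
  have growth: "(\<lambda>l. z l $ d) \<in> \<Theta>[at 0 within D\<^sub>1 \<inter> D\<^sub>2](\<lambda>l. sqrt \<bar>l\<bar>)"
    if "((\<lambda>l. z l /\<^sub>R sqrt \<bar>l\<bar>) \<longlongrightarrow> x) ?F" "x $ d \<noteq> 0" for z x d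
  proof (rule bigtheta_component_of_scaled_limit)
    show "((\<lambda>l. z l /\<^sub>R sqrt \<bar>l\<bar>) \<longlongrightarrow> x) (at 0 within D\<^sub>1 \<inter> D\<^sub>2)"
      using D2(3) by (intro tendsto_within_subset[OF that(1)]) auto
  qed (use that(2) in \<open>auto simp: eventually_at_filter\<close>)
  note branch = bifurcation_branch_join[OF assms(1,2) equilibrium b D2(2) Int_lower1 nonzero]
  show ?thesis
  proof (intro exI[of _ D\<^sub>2] conjI allI impI)
    show "\<exists>l\<in>D\<^sub>1 \<inter> D\<^sub>2. y l \<noteq> y' l" using nonzero on_D2 by blast
  qed (use zero on_D2 limit D2(1) \<open>\<alpha> \<noteq> 0\<close> in \<open>auto intro: branch growth\<close>)
qed

theorem proposition3p14:
  fixes c :: "'p::finite"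
    and W1 :: "real^'p^'p"
    and W2 :: "real^('q::finite option)^('q option)"
    and g :: "real \<times> real \<Rightarrow> real"
    and h :: "real \<times> real \<times> real \<Rightarrow> real"
    and v :: "real^'q"
    and \<beta> :: real
  defines "N \<equiv> coalescence c W1 W2"
    and "J \<equiv> without_c (jacobian_origin (admissible g h W2))"
  assumes "connected_network W1" and "connected_network W2"
    and "feedforward W2"
    and "smooth g" and "smooth h" and "diffusive h"
    and "\<forall>l. admissible g h N 0 l = 0"
    and "\<exists>!\<mu>. eigenvalue (laplacian N) \<mu> \<and> bifurcation_condition g h \<mu>"
    and "\<exists>\<mu>. eigenvalue (laplacian W1) \<mu> \<and> bifurcation_condition g h \<mu>"
    and "\<exists>\<mu>. eigenvalue (laplacian W2) \<mu> \<and> bifurcation_condition g h \<mu>"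
    and "rank J = CARD('q option) - 2"
    and "v \<noteq> 0" and "J *v v = 0"
    and "\<beta> *\<^sub>R c_column (laplacian W2) \<notin> range ((*v) J)"
    and "hessian_vector (admissible g h W2) v \<notin> range ((*v) J)"
  shows "\<exists>S\<in>{{0..}, {..0}}. \<forall>D1 b.
    bifurcation_branch (admissible g h W1) D1 b \<and>
    ((\<lambda>l. b l $ c) has_real_derivative \<beta>) (at 0 within D1) \<and>
    D1 \<inter> S \<noteq> {0} \<longrightarrow>
    (\<exists>D2 b21 b22.
      branch_domain D2 \<and>
      bifurcation_branch (admissible g h N) (D1 \<inter> D2) (\<lambda>l. join (b l) (b21 l)) \<and>
      bifurcation_branch (admissible g h N) (D1 \<inter> D2) (\<lambda>l. join (b l) (b22 l)) \<and>
      (\<exists>l\<in>D1 \<inter> D2. b21 l \<noteq> b22 l) \<and>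
      (\<forall>d. v $ d \<noteq> 0 \<longrightarrow>
        (\<lambda>l. join (b l) (b21 l) $ Inr d) \<in> \<Theta>[at 0 within (D1 \<inter> D2)](\<lambda>l. sqrt \<bar>l\<bar>) \<and>
        (\<lambda>l. join (b l) (b22 l) $ Inr d) \<in> \<Theta>[at 0 within (D1 \<inter> D2)](\<lambda>l. sqrt \<bar>l\<bar>)))"
proof -
  note feedforward = assms(5) and smooth = assms(6,7) and diffusive = assms(8) and v = assms(14,15)
  have rank: "rank J = CARD('q) - 1" using assms(13) by simp
  have forcing: "\<beta> *\<^sub>R c_column (jacobian_origin (admissible g h W2)) \<notin> range ((*v) J)"
    using forcing_not_in_range[OF feedforward smooth diffusive] assms(10,16) rank
    by (simp add: N_def J_def)
  have equilibrium: "driven g h W2 (0, 0, l) = 0" for l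
    by (rule driven_equilibrium[OF feedforward diffusive assms(9)[unfolded N_def, rule_format]])
  obtain \<sigma> \<alpha> :: real where \<sigma>: "\<sigma> \<in> {1, -1}" and \<alpha>: "\<alpha> > 0" and branches:
    "\<And>D s. D \<subseteq> {l. 0 \<le> \<sigma> * l} \<Longrightarrow> s 0 = 0 \<Longrightarrow> (s has_real_derivative \<beta>) (at 0 within D) \<Longrightarrow>
      \<exists>y y'. square_root_branch (driven g h W2) (\<lambda>l. (s l, l)) D (\<alpha> *\<^sub>R v) y \<and>
        square_root_branch (driven g h W2) (\<lambda>l. (s l, l)) D (- \<alpha> *\<^sub>R v) y'"
    using driven_fold_branches[OF smooth equilibrium] rank v forcing assms(17)
    unfolding J_def by blast
  show ?thesis
  proof (intro bexI[of _ "{l. 0 \<le> \<sigma> * l}"] allI impI, elim conjE, goal_cases)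
    case N1: (1 D1 b)
    have b0: "b 0 $ c = 0" using N1(1) by (simp add: bifurcation_branch_def equilibrium_branch_def)
    from branches[OF Int_lower2 b0 has_field_derivative_subset[OF N1(2) Int_lower1]]
    show ?case
      using coalescence_branch_pair[OF feedforward diffusive equilibrium N1(1) \<sigma> N1(3) _ _
          less_imp_neq[OF \<alpha>, symmetric] v(1)]
      unfolding N_def by blast
  qed (use \<sigma> in auto)
qed

end
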